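(* Let $\Lambda\subseteq\mathbb{R}^d$ be a lattice whose Voronoi cell $\operatorname{VC}(\Lambda)$ is a zonotope. Then $\operatorname{xc}(\operatorname{VC}(\Lambda))\le d(d+1)$.
   Context: A lattice is the set of all integer linear combinations of finitely many linearly independent vectors in $\mathbb{R}^d$. The Voronoi cell of $\Lambda$ is $\operatorname{VC}(\Lambda)=\{x\in\operatorname{lin}(\Lambda): \|x\|\le\|x-z\| \text{ for all } z\in\Lambda\}$, where $\operatorname{lin}$ denotes linear hull and $\|\cdot\|$ the Euclidean norm. A zonotope is a Minkowski sum of finitely many line segments. For a polytope $P$, the extension complexity $\operatorname{xc}(P)$ is the minimum number of facets of any polyhedron that can be mapped onto $P$ by a linear map. *)

theory Defs
  imports "HOL-Analysis.Analysis" "HOL-Analysis.Finite_Function_Topology"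
begin

definition is_lattice :: "(real ^ 'n) set \<Rightarrow> bool" where
  "is_lattice L \<longleftrightarrow>
     (\<exists>B. finite B \<and> independent B \<and> L = range (\<lambda>c :: real ^ 'n \<Rightarrow> int. \<Sum>b\<in>B. of_int (c b) *\<^sub>R b))"

definition voronoi_cell :: "(real ^ 'n) set \<Rightarrow> (real ^ 'n) set" where
  "voronoi_cell L = {x \<in> span L. \<forall>z\<in>L. norm x \<le> norm (x - z)}"

text \<open>The sum below is the Minkowski sum, by the pointwise addition of sets from
  \<^theory>\<open>HOL-Library.Set_Algebras\<close>.\<close>

definition zonotope :: "(real ^ 'n) set \<Rightarrow> bool" where
  "zonotope Z \<longleftrightarrow>
     (\<exists>(k::nat) (a :: nat \<Rightarrow> real ^ 'n) b. Z = (\<Sum>i<k. closed_segment (a i) (b i)))"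

text \<open>
  The dimension of an extension of a polytope is not bounded in advance, so it cannot be
  a type. The space of dimension \<open>m\<close> is therefore represented by those finitely
  supported sequences that vanish outside \<open>{..<m}\<close>. All these spaces are linear subspaces
  of the one real vector space \<^typ>\<open>nat \<Rightarrow>\<^sub>0 real\<close>, so that \<^const>\<open>linear\<close>,
  \<^const>\<open>face_of\<close> and \<^const>\<open>dim\<close> apply; \<^const>\<open>polyhedron\<close>, \<^const>\<open>aff_dim\<close> and
  \<^const>\<open>facet_of\<close> demand a Euclidean space as a type and are restated below.
\<close>

definition coord_space :: "nat \<Rightarrow> (nat \<Rightarrow>\<^sub>0 real) set" where
  "coord_space m = {x. Poly_Mapping.keys x \<subseteq> {..<m}}"

definition polyhedron_in :: "nat \<Rightarrow> (nat \<Rightarrow>\<^sub>0 real) set \<Rightarrow> bool" where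
  "polyhedron_in m Q \<longleftrightarrow>
     (\<exists>H :: ((nat \<Rightarrow> real) \<times> real) set. finite H \<and>
        Q = {x \<in> coord_space m. \<forall>(a, \<beta>)\<in>H. (\<Sum>i<m. a i * Poly_Mapping.lookup x i) \<le> \<beta>})"

text \<open>For a nonempty set this is the dimension of its affine hull.\<close>

definition affine_dim :: "'a::real_vector set \<Rightarrow> nat" where
  "affine_dim S = dim {x - y | x y. x \<in> S \<and> y \<in> S}"

definition facets :: "'a::real_vector set \<Rightarrow> 'a set set" where
  "facets Q = {F. F face_of Q \<and> F \<noteq> {} \<and> affine_dim Q = affine_dim F + 1}"

lemma affine_dim_eq_aff_dim:
  fixes S :: "'a::euclidean_space set"
  assumes "S \<noteq> {}"
  shows "int (affine_dim S) = aff_dim S"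
proof -
  obtain a where a: "a \<in> S" using assms by blast
  let ?D = "{x - y | x y. x \<in> S \<and> y \<in> S}" and ?T = "(+) (- a) ` S"
  have "?D \<subseteq> span ?T"
  proof
    fix z assume "z \<in> ?D"
    then obtain x y where z: "z = x - y" "x \<in> S" "y \<in> S" by blast
    have "(- a + x) - (- a + y) \<in> span ?T"
      using z by (intro span_diff span_base imageI)
    then show "z \<in> span ?T" by (simp add: z)
  qed
  moreover have "?T \<subseteq> ?D"
  proof
    fix z assume "z \<in> ?T"
    then obtain x where "x \<in> S" "z = x - a" by auto
    then show "z \<in> ?D" using a by blast
  qed
  ultimately have "span ?D = span ?T"
    using span_eq[of ?D ?T] span_superset[of ?D] by (meson subset_trans)
  then have "dim ?D = dim ?T"
    using dim_span[of ?D] dim_span[of ?T] by simp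
  moreover have "aff_dim S = int (dim ?T)"
    using a by (intro aff_dim_eq_dim hull_inc)
  ultimately show ?thesis by (simp add: affine_dim_def)
qed

lemma mem_facets_iff:
  fixes Q :: "'a::euclidean_space set"
  shows "F \<in> facets Q \<longleftrightarrow> F facet_of Q"
proof -
  have "affine_dim Q = affine_dim F + 1 \<longleftrightarrow> aff_dim F = aff_dim Q - 1" if "F face_of Q" "F \<noteq> {}"
  proof -
    have "Q \<noteq> {}" using face_of_imp_subset[OF that(1)] that(2) by auto
    then show ?thesis using affine_dim_eq_aff_dim[of F] affine_dim_eq_aff_dim[of Q] that(2) by linarith
  qed
  then show ?thesis by (auto simp: facets_def facet_of_def)
qed

text \<open>A polyhedron has only finitely many facets, so \<^const>\<open>card\<close> counts them. The infimum of
  a nonempty set of extended naturals is attained; it is \<open>\<infinity>\<close> if there is no extension.\<close>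

definition extension_complexity :: "(real ^ 'n) set \<Rightarrow> enat" where
  "extension_complexity P =
     Inf {enat (card (facets Q)) | m Q f.
            polyhedron_in m Q \<and> linear f \<and> f ` Q = P}"

end

theory Submission
  imports Defs
begin

text \<open>
  Write the Voronoi cell as \<open>Z = \<Sum> [-g, g]\<close> with pairwise nonparallel generators \<open>g\<close>; then \<open>Z\<close> is a
  linear image of a cube with two facets per generator, and it suffices to bound the number of
  generators by \<open>d (d + 1) / 2\<close>.

  Every line in direction \<open>g\<close> that meets a tile \<open>z + Z\<close> of the lattice tiling meets it in a segment
  of length at least \<open>2 |g|\<close>. Hence the set of slopes \<open>g \<bullet> z\<close> of the tiles met by such a line does
  not change when the line is moved: all lines see all the slopes \<open>g \<bullet> L\<close>. So these are discrete, of
  the form \<open>c \<int>\<close>, and two tiles with a common point have equal or consecutive slopes. With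
  \<open>u = g / c\<close> this gives \<open>\<bar>u \<bullet> v\<bar> \<le> 1\<close> for all \<open>u\<close> whenever \<open>v / 2 \<in> Z\<close>, and each class of
  \<open>L / 2 L\<close> contains such a reduced vector \<open>v\<close>. It follows that the \<open>u\<close> are pairwise distinct mod 2
  and, by independence of characters of \<open>L / 2 L\<close>, that the quadratic forms \<open>(u \<bullet> x)\<^sup>2\<close> are linearly
  independent. The space of quadratic forms has dimension \<open>d (d + 1) / 2\<close>.
\<close>

subsection \<open>Centred zonotopes\<close>

text \<open>The Minkowski sum of the segments \<open>[-u, u]\<close> for \<open>u\<close> in
  \<open>S\<close>, indexed by the set itself so that \<open>card S\<close> counts the
  generators.\<close>

definition zon :: "'a::real_vector set \<Rightarrow> 'a set" where
  "zon S = {\<Sum>u\<in>S. t u *\<^sub>R u | t. \<forall>u\<in>S. \<bar>t u\<bar> \<le> (1::real)}"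

lemma zon_insert:
  assumes "finite S" "u \<notin> S"
  shows "zon (insert u S) = {r *\<^sub>R u + y | r y. \<bar>r\<bar> \<le> 1 \<and> y \<in> zon S}" (is "_ = ?R")
proof
  show "zon (insert u S) \<subseteq> ?R" using assms by (fastforce simp: zon_def)
  show "?R \<subseteq> zon (insert u S)"
  proof
    fix x assume "x \<in> ?R"
    then obtain r t where t: "\<bar>r\<bar> \<le> 1" "\<forall>v\<in>S. \<bar>t v\<bar> \<le> 1" "x = r *\<^sub>R u + (\<Sum>v\<in>S. t v *\<^sub>R v)"
      by (auto simp: zon_def)
    have "(\<Sum>v\<in>S. (t(u := r)) v *\<^sub>R v) = (\<Sum>v\<in>S. t v *\<^sub>R v)"
      using assms by (intro sum.cong) auto
    then have "x = (\<Sum>v\<in>insert u S. (t(u := r)) v *\<^sub>R v)" using assms t by simp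
    moreover have "\<forall>v\<in>insert u S. \<bar>(t(u := r)) v\<bar> \<le> 1" using t by auto
    ultimately show "x \<in> zon (insert u S)" unfolding zon_def by blast
  qed
qed

lemma zero_in_zon: "0 \<in> zon S"
  unfolding zon_def by (rule CollectI, rule exI[of _ "\<lambda>_. 0"]) simp

lemma zon_uminus: "x \<in> zon S \<Longrightarrow> - x \<in> zon S"
  unfolding zon_def
proof clarify
  fix t assume "\<forall>u\<in>S. \<bar>t u\<bar> \<le> (1::real)"
  then show "\<exists>t'. - (\<Sum>u\<in>S. t u *\<^sub>R u) = (\<Sum>u\<in>S. t' u *\<^sub>R u) \<and> (\<forall>u\<in>S. \<bar>t' u\<bar> \<le> 1)"
    by (intro exI[of _ "\<lambda>u. - t u"]) (simp add: sum_negf)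
qed

lemma mem_zon:
  assumes "finite S" "u \<in> S"
  shows "u \<in> zon S"
proof -
  have "u = (\<Sum>v\<in>S. (if v = u then 1 else 0) *\<^sub>R v)"
    using assms by (simp add: if_distrib[of "\<lambda>r. r *\<^sub>R _"] cong: if_cong)
  then show ?thesis unfolding zon_def
    by (intro CollectI exI[of _ "\<lambda>v. if v = u then 1 else 0"]) auto
qed

lemma bounded_zon: "bounded (zon (S :: 'a::real_normed_vector set))"
  unfolding bounded_iff
proof (intro exI ballI)
  fix x assume "x \<in> zon S"
  then obtain t where t: "\<forall>u\<in>S. \<bar>t u\<bar> \<le> 1" "x = (\<Sum>u\<in>S. t u *\<^sub>R u)" by (auto simp: zon_def)
  then have "norm x \<le> (\<Sum>u\<in>S. \<bar>t u\<bar> * norm u)" by (simp add: sum_norm_le)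
  also have "\<dots> \<le> (\<Sum>u\<in>S. norm u)" using t by (intro sum_mono mult_left_le_one_le) auto
  finally show "norm x \<le> (\<Sum>u\<in>S. norm u)" .
qed

text \<open>A line in direction \<open>g\<close> through a point of \<open>Z\<close> stays in \<open>Z\<close> for a length of
  at least \<open>2 * norm g\<close>.\<close>

definition has_chords :: "'a::real_vector set \<Rightarrow> 'a \<Rightarrow> bool" where
  "has_chords Z g \<longleftrightarrow> (\<forall>x\<in>Z. \<exists>b\<in>{0..2}. \<forall>t\<in>{- b..2 - b}. x + t *\<^sub>R g \<in> Z)"

text \<open>Moving along \<open>u\<close> changes only the coefficient \<open>r\<close> of
  \<open>u\<close>, which may run through all of \<open>[-1, 1]\<close>; hence
  \<open>b = 1 + r\<close>.\<close>

lemma zon_has_chords: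
  assumes "finite S" "u \<in> S"
  shows "has_chords (zon S) u"
  unfolding has_chords_def
proof
  have S: "insert u (S - {u}) = S" using assms by auto
  note ins = zon_insert[of "S - {u}" u, unfolded S]
  fix x assume "x \<in> zon S"
  then obtain r y where r: "\<bar>r\<bar> \<le> 1" "y \<in> zon (S - {u})" "x = r *\<^sub>R u + y"
    using ins assms by auto
  show "\<exists>b\<in>{0..2}. \<forall>t\<in>{- b..2 - b}. x + t *\<^sub>R u \<in> zon S"
  proof (intro bexI ballI)
    fix t assume "t \<in> {- (1 + r)..2 - (1 + r)}"
    then have "\<bar>r + t\<bar> \<le> 1" by auto
    moreover have "x + t *\<^sub>R u = (r + t) *\<^sub>R u + y" using r by (simp add: algebra_simps)
    ultimately show "x + t *\<^sub>R u \<in> zon S" using ins assms r(2) by auto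
  qed (use r in auto)
qed

section \<open>Removing parallel generators\<close>

text \<open>Negative \<open>r\<close> is included, so a vector and its opposite cannot both be
  generators; the count of distinct functionals up to sign relies on this.\<close>

definition nonparallel :: "'a::real_vector set \<Rightarrow> bool" where
  "nonparallel S \<longleftrightarrow> 0 \<notin> S \<and> (\<forall>u\<in>S. \<forall>v\<in>S. \<forall>r. v = r *\<^sub>R u \<longrightarrow> v = u)"

lemma sum_parallel_segments:
  fixes u :: "'a::real_vector"
  shows "{s *\<^sub>R u + r *\<^sub>R (c *\<^sub>R u) | s r. \<bar>s\<bar> \<le> 1 \<and> \<bar>r\<bar> \<le> 1} =
   {s *\<^sub>R ((1 + \<bar>c\<bar>) *\<^sub>R u) | s. \<bar>s\<bar> \<le> (1::real)}" (is "?A = ?B")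
proof
  show "?A \<subseteq> ?B"
  proof clarify
    fix s r :: real assume "\<bar>s\<bar> \<le> 1" "\<bar>r\<bar> \<le> 1"
    then have "\<bar>s + r * c\<bar> \<le> 1 + \<bar>c\<bar>"
      using mult_right_mono[of "\<bar>r\<bar>" 1 "\<bar>c\<bar>"] abs_triangle_ineq[of s "r * c"] by (simp add: abs_mult)
    then have "\<bar>(s + r * c) / (1 + \<bar>c\<bar>)\<bar> \<le> 1" by (simp add: abs_divide)
    moreover have "s *\<^sub>R u + r *\<^sub>R (c *\<^sub>R u) = ((s + r * c) / (1 + \<bar>c\<bar>)) *\<^sub>R ((1 + \<bar>c\<bar>) *\<^sub>R u)"
    proof -
      have "1 + \<bar>c\<bar> \<noteq> 0" by (simp add: add_nonneg_eq_0_iff)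
      then have "((s + r * c) / (1 + \<bar>c\<bar>)) *\<^sub>R ((1 + \<bar>c\<bar>) *\<^sub>R u) = (s + r * c) *\<^sub>R u" by simp
      then show ?thesis by (simp add: scaleR_add_left)
    qed
    ultimately show "\<exists>s'. s *\<^sub>R u + r *\<^sub>R (c *\<^sub>R u) = s' *\<^sub>R ((1 + \<bar>c\<bar>) *\<^sub>R u) \<and> \<bar>s'\<bar> \<le> 1"
      by blast
  qed
  show "?B \<subseteq> ?A"
  proof clarify
    fix s :: real assume "\<bar>s\<bar> \<le> 1"
    \<comment> \<open>The second segment gets the coefficient \<open>s * sgn c\<close>, because
      \<open>sgn c * c\<close> is \<open>\<bar>c\<bar>\<close>.\<close>
    moreover have "s *\<^sub>R ((1 + \<bar>c\<bar>) *\<^sub>R u) = s *\<^sub>R u + (s * sgn c) *\<^sub>R (c *\<^sub>R u)"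
      by (simp add: algebra_simps abs_sgn)
    moreover have "\<bar>s * sgn c\<bar> \<le> 1" using \<open>\<bar>s\<bar> \<le> 1\<close> by (auto simp: abs_mult sgn_if)
    ultimately show "\<exists>s' r. s *\<^sub>R ((1 + \<bar>c\<bar>) *\<^sub>R u) = s' *\<^sub>R u + r *\<^sub>R (c *\<^sub>R u) \<and> \<bar>s'\<bar> \<le> 1 \<and> \<bar>r\<bar> \<le> 1"
      by blast
  qed
qed

text \<open>A zero \<open>g\<close> changes nothing, a \<open>g\<close> parallel to some
  \<open>u\<close> in \<open>S\<close> is absorbed by lengthening \<open>u\<close>, and any other
  \<open>g\<close> becomes a new generator.\<close>

lemma zon_add_segment:
  assumes "finite S" "nonparallel S"
  obtains S' where "finite S'" "nonparallel S'"
    "zon S' = {r *\<^sub>R g + y | r y. \<bar>r\<bar> \<le> 1 \<and> y \<in> zon S}"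
proof -
  consider "g = 0" | u c where "g \<noteq> 0" "u \<in> S" "g = c *\<^sub>R u" 
    | "g \<noteq> 0" "\<And>u c. u \<in> S \<Longrightarrow> g \<noteq> c *\<^sub>R u" by blast
  then show thesis
  proof cases
    case 1
    have "{r *\<^sub>R g + y | r y. \<bar>r\<bar> \<le> 1 \<and> y \<in> zon S} = zon S"
    proof (intro equalityI subsetI)
      fix x assume "x \<in> zon S"
      then have "x = 0 *\<^sub>R g + x \<and> \<bar>0::real\<bar> \<le> 1 \<and> x \<in> zon S" by simp
      then show "x \<in> {r *\<^sub>R g + y | r y. \<bar>r\<bar> \<le> 1 \<and> y \<in> zon S}" by blast
    qed (use 1 in auto)
    then show ?thesis using that[of S] assms by simp
  next
    case 2
    define T where "T = S - {u}"
    define v where "v = (1 + \<bar>c\<bar>) *\<^sub>R u"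
    have S: "S = insert u T" "u \<notin> T" "finite T" using assms 2 by (auto simp: T_def)
    have T: "w \<noteq> r *\<^sub>R u \<and> u \<noteq> r *\<^sub>R w" if "w \<in> T" for w r
    proof -
      have "w \<in> S" "w \<noteq> u" using that by (auto simp: T_def)
      then show ?thesis using assms(2) \<open>u \<in> S\<close> unfolding nonparallel_def by metis
    qed
    have pos: "1 + \<bar>c\<bar> \<noteq> 0" by (simp add: add_nonneg_eq_0_iff)
    have u: "u = (1 / (1 + \<bar>c\<bar>)) *\<^sub>R v" using pos by (simp add: v_def)
    have T': "w \<noteq> r *\<^sub>R v" "v \<noteq> r *\<^sub>R w" if "w \<in> T" for w r
    proof -
      show "w \<noteq> r *\<^sub>R v" using T[OF that, of "r * (1 + \<bar>c\<bar>)"] by (simp add: v_def)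
      show "v \<noteq> r *\<^sub>R w" using T[OF that, of "1 / (1 + \<bar>c\<bar>) * r"] u by auto
    qed
    have "v \<noteq> 0" using u 2 by auto
    have "v \<notin> T" using T'(1)[of v 1] by auto
    have "zon (insert v T) = {x + y | x y. x \<in> {s *\<^sub>R v | s. \<bar>s\<bar> \<le> 1} \<and> y \<in> zon T}"
      using zon_insert[OF S(3) \<open>v \<notin> T\<close>] by blast
    also have "\<dots> = {x + y | x y. x \<in> {s *\<^sub>R u + r *\<^sub>R g | s r. \<bar>s\<bar> \<le> 1 \<and> \<bar>r\<bar> \<le> 1} \<and> y \<in> zon T}"
      unfolding v_def 2(3) sum_parallel_segments ..
    also have "\<dots> = {r *\<^sub>R g + y | r y. \<bar>r\<bar> \<le> 1 \<and> y \<in> zon S}"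
    proof (intro equalityI subsetI)
      fix z assume "z \<in> {x + y | x y. x \<in> {s *\<^sub>R u + r *\<^sub>R g | s r. \<bar>s\<bar> \<le> 1 \<and> \<bar>r\<bar> \<le> 1} \<and> y \<in> zon T}"
      then obtain s r y where *: "z = s *\<^sub>R u + r *\<^sub>R g + y" "\<bar>s\<bar> \<le> 1" "\<bar>r\<bar> \<le> 1" "y \<in> zon T" by blast
      have "s *\<^sub>R u + y \<in> zon S" unfolding S(1) zon_insert[OF S(3,2)] using * by blast
      moreover have "z = r *\<^sub>R g + (s *\<^sub>R u + y)" using * by simp
      ultimately show "z \<in> {r *\<^sub>R g + y | r y. \<bar>r\<bar> \<le> 1 \<and> y \<in> zon S}" using * by blast
    next
      fix z assume "z \<in> {r *\<^sub>R g + y | r y. \<bar>r\<bar> \<le> 1 \<and> y \<in> zon S}"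
      then obtain s r y where *: "z = r *\<^sub>R g + (s *\<^sub>R u + y)" "\<bar>s\<bar> \<le> 1" "\<bar>r\<bar> \<le> 1" "y \<in> zon T"
        unfolding S(1) zon_insert[OF S(3,2)] by blast
      then have "z = (s *\<^sub>R u + r *\<^sub>R g) + y" by simp
      with * show "z \<in> {x + y | x y. x \<in> {s *\<^sub>R u + r *\<^sub>R g | s r. \<bar>s\<bar> \<le> 1 \<and> \<bar>r\<bar> \<le> 1} \<and> y \<in> zon T}"
        by blast
    qed
    finally have "zon (insert v T) = {r *\<^sub>R g + y | r y. \<bar>r\<bar> \<le> 1 \<and> y \<in> zon S}" .
    moreover have "nonparallel (insert v T)"
      unfolding nonparallel_def
    proof (intro conjI ballI allI impI)
      fix w w' r assume *: "w \<in> insert v T" "w' \<in> insert v T" "w' = r *\<^sub>R w"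
      show "w' = w"
      proof (cases "w = v \<or> w' = v")
        case True
        then show ?thesis using * T' by auto
      next
        case False
        then have "w \<in> S" "w' \<in> S" using * by (auto simp: T_def)
        then show ?thesis using assms(2) *(3) by (auto simp: nonparallel_def)
      qed
    qed (use assms(2) \<open>v \<noteq> 0\<close> in \<open>auto simp: nonparallel_def T_def\<close>)
    ultimately show ?thesis using that[of "insert v T"] S(3) by blast
  next
    case 3
    have "g \<notin> S" using 3(2)[of g 1] by auto
    moreover have "nonparallel (insert g S)"
      unfolding nonparallel_def
    proof (intro conjI ballI allI impI)
      fix u v r assume *: "u \<in> insert g S" "v \<in> insert g S" "v = r *\<^sub>R u"
      show "v = u"
      proof (cases "u = g \<and> v \<in> S")
        case True
        \<comment> \<open>\<open>v\<close> lies in \<open>S\<close> and so is not 0. Dividing by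
          \<open>r\<close> makes \<open>g\<close> a multiple of \<open>v\<close>, against the case
          assumption.\<close>
        then have "r \<noteq> 0" using assms(2) * by (auto simp: nonparallel_def)
        then have "g = (1 / r) *\<^sub>R v" using * True by simp
        then show ?thesis using 3 True by blast
      next
        case False
        then consider "u = g" "v = g" | "u \<in> S" "v = g" | "u \<in> S" "v \<in> S" using * by blast
        then show ?thesis using *(3) 3(2)[of u r] assms(2) by cases (auto simp: nonparallel_def)
      qed
    qed (use 3 assms in \<open>auto simp: nonparallel_def\<close>)
    ultimately show ?thesis using that[of "insert g S"] zon_insert[of S g] assms(1) by blast
  qed
qed

lemma closed_segment_centred:
  "closed_segment a b = {(1/2) *\<^sub>R (a + b) + r *\<^sub>R ((1/2) *\<^sub>R (b - a)) | r. \<bar>r\<bar> \<le> 1}" (is "_ = ?R")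
proof -
  have eq: "(1/2) *\<^sub>R (a + b) + r *\<^sub>R ((1/2) *\<^sub>R (b - a)) = ((1 - r) / 2) *\<^sub>R a + ((1 + r) / 2) *\<^sub>R b" for r
    by (simp add: scaleR_right_distrib scaleR_right_diff_distrib diff_divide_distrib add_divide_distrib
        scaleR_left_diff_distrib scaleR_left_distrib)
  show ?thesis
  proof (intro equalityI subsetI)
    fix x assume "x \<in> closed_segment a b"
    then obtain u where u: "0 \<le> u" "u \<le> 1" "x = (1 - u) *\<^sub>R a + u *\<^sub>R b"
      by (auto simp: closed_segment_def)
    have "x = ((1 - (2 * u - 1)) / 2) *\<^sub>R a + ((1 + (2 * u - 1)) / 2) *\<^sub>R b"
      unfolding u by simp
    moreover have "\<bar>2 * u - 1\<bar> \<le> 1" using u by auto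
    ultimately show "x \<in> ?R" unfolding eq by blast
  next
    fix x assume "x \<in> ?R"
    then obtain r where r: "\<bar>r\<bar> \<le> 1" "x = ((1 - r) / 2) *\<^sub>R a + ((1 + r) / 2) *\<^sub>R b"
      unfolding eq by blast
    have "x = (1 - (1 + r) / 2) *\<^sub>R a + ((1 + r) / 2) *\<^sub>R b"
      unfolding r by (simp add: field_simps)
    moreover have "0 \<le> (1 + r) / 2" "(1 + r) / 2 \<le> 1" using r by auto
    ultimately show "x \<in> closed_segment a b" unfolding closed_segment_def by blast
  qed
qed

text \<open>Each segment is its midpoint plus a centred segment; the midpoints add up to
  \<open>p\<close> and the centred segments are merged one by one.\<close>

lemma sum_segments_eq_translated_zon:
  fixes a b :: "nat \<Rightarrow> 'a::real_vector"
  shows "\<exists>p S. finite S \<and> nonparallel S \<and> (\<Sum>i<k. closed_segment (a i) (b i)) = (+) p ` zon S"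
proof (induction k)
  case 0
  have "zon {} = {0 :: 'a}" by (auto simp: zon_def)
  then show ?case
    by (intro exI[of _ 0] exI[of _ "{}"]) (simp add: nonparallel_def set_zero)
next
  case (Suc k)
  then obtain p S where S: "finite S" "nonparallel S"
    "(\<Sum>i<k. closed_segment (a i) (b i)) = (+) p ` zon S" by blast
  define q g where "q = (1/2) *\<^sub>R (a k + b k)" and "g = (1/2) *\<^sub>R (b k - a k)"
  obtain S' where S': "finite S'" "nonparallel S'"
    "zon S' = {r *\<^sub>R g + y | r y. \<bar>r\<bar> \<le> 1 \<and> y \<in> zon S}"
    using zon_add_segment[OF S(1,2)] by blast
  have "(\<Sum>i<Suc k. closed_segment (a i) (b i)) = (+) p ` zon S + {q + r *\<^sub>R g | r. \<bar>r\<bar> \<le> 1}"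
    by (simp add: S closed_segment_centred[of "a k" "b k"] q_def g_def)
  also have "\<dots> = (+) (p + q) ` zon S'"
  proof (intro equalityI subsetI)
    fix x assume "x \<in> (+) p ` zon S + {q + r *\<^sub>R g | r. \<bar>r\<bar> \<le> 1}"
    then obtain y r where *: "y \<in> zon S" "\<bar>r\<bar> \<le> 1" "x = (p + y) + (q + r *\<^sub>R g)"
      by (auto elim!: set_plus_elim)
    then have "x = (p + q) + (r *\<^sub>R g + y)" "r *\<^sub>R g + y \<in> zon S'" unfolding S' by (auto simp: algebra_simps)
    then show "x \<in> (+) (p + q) ` zon S'" by blast
  next
    fix x assume "x \<in> (+) (p + q) ` zon S'"
    then obtain y r where *: "y \<in> zon S" "\<bar>r\<bar> \<le> 1" "x = (p + q) + (r *\<^sub>R g + y)"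
      unfolding S' by auto
    then have "x = (p + y) + (q + r *\<^sub>R g)" by (simp add: algebra_simps)
    moreover have "p + y \<in> (+) p ` zon S" using * by blast
    ultimately show "x \<in> (+) p ` zon S + {q + r *\<^sub>R g | r. \<bar>r\<bar> \<le> 1}" 
      using *(2) by (simp only:) (intro set_plus_intro, blast+)
  qed
  finally show ?case using S' by blast
qed

text \<open>As \<open>zon S\<close> is symmetric too, it is mapped into itself by the translation by
  \<open>2 p\<close>. Iterating from 0 leaves every bounded set unless \<open>p = 0\<close>.\<close>

lemma symmetric_translated_zon:
  fixes S :: "'a::real_inner set"
  assumes "finite S" and sym: "\<And>x. x \<in> (+) p ` zon S \<Longrightarrow> - x \<in> (+) p ` zon S"
  shows "p = 0"
proof -
  have step: "y + 2 *\<^sub>R p \<in> zon S" if "y \<in> zon S" for y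
  proof -
    have "- (p + - (- y)) \<in> (+) p ` zon S" using sym that by force
    then obtain y' where "y' \<in> zon S" "- (p + y) = p + y'" by auto
    then have "y + 2 *\<^sub>R p = - y'" by (simp add: scaleR_2 algebra_simps)
        (metis add.assoc add.commute add_uminus_conv_diff diff_add_cancel minus_add_distrib minus_minus)
    then show ?thesis using \<open>y' \<in> zon S\<close> zon_uminus by metis
  qed
  have many: "(2 * real n) *\<^sub>R p \<in> zon S" for n
  proof (induction n)
    case (Suc n)
    from step[OF this] show ?case by (simp add: algebra_simps)
  qed (simp add: zero_in_zon)
  obtain B where B: "\<And>x. x \<in> zon S \<Longrightarrow> norm x \<le> B" using bounded_zon[of S] by (auto simp: bounded_iff)
  show ?thesis
  proof (rule ccontr)
    assume "p \<noteq> 0"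
    then obtain n where "B < real n * norm p" using reals_Archimedean3[of "norm p"] by auto
    moreover have "norm ((2 * real n) *\<^sub>R p) \<le> B" by (intro B many)
    moreover have "real n * norm p \<ge> 0" by simp
    ultimately show False by simp
  qed
qed

subsection \<open>The cube and its facets\<close>

lemma lookup_scaleR: "Poly_Mapping.lookup (r *\<^sub>R x) i = r *\<^sub>R Poly_Mapping.lookup x i"
  for x :: "'a \<Rightarrow>\<^sub>0 real"
proof -
  have "{i. r *\<^sub>R Poly_Mapping.lookup x i \<noteq> 0} \<subseteq> {i. Poly_Mapping.lookup x i \<noteq> 0}" by auto
  then have "finite {i. r *\<^sub>R Poly_Mapping.lookup x i \<noteq> 0}" using finite_lookup finite_subset by metis
  then show ?thesis by (simp add: scaleR_poly_mapping_def Abs_poly_mapping_inverse)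
qed

lemma coord_space_iff: "x \<in> coord_space m \<longleftrightarrow> (\<forall>i\<ge>m. Poly_Mapping.lookup x i = 0)"
  by (auto simp: coord_space_def in_keys_iff subset_iff not_le)

definition cube :: "nat \<Rightarrow> (nat \<Rightarrow>\<^sub>0 real) set" where
  "cube m = {x \<in> coord_space m. \<forall>i<m. \<bar>Poly_Mapping.lookup x i\<bar> \<le> 1}"

lemma polyhedron_in_cube: "polyhedron_in m (cube m)"
proof -
  define H :: "((nat \<Rightarrow> real) \<times> real) set"
    where "H = (\<lambda>(i, s). (\<lambda>j. if j = i then s else 0, 1)) ` ({..<m} \<times> {1, -1})"
  have "cube m = {x \<in> coord_space m. \<forall>(a, \<beta>)\<in>H. (\<Sum>i<m. a i * Poly_Mapping.lookup x i) \<le> \<beta>}"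
    by (auto simp: cube_def H_def if_distrib[of "\<lambda>r. r * _"] abs_le_iff ball_Un cong: if_cong)
  moreover have "finite H" by (simp add: H_def)
  ultimately show ?thesis unfolding polyhedron_in_def by blast
qed

text \<open>The coordinates of the cube serve as the coefficients of the generators, enumerated by
  \<open>h\<close>.\<close>

lemma zon_eq_linear_image_cube:
  assumes "finite S"
  obtains f :: "(nat \<Rightarrow>\<^sub>0 real) \<Rightarrow> 'a::real_vector" where "linear f" "f ` cube (card S) = zon S"
proof -
  obtain h where h: "bij_betw h {..<card S} S"
    using ex_bij_betw_nat_finite[OF assms] by (auto simp: atLeast0LessThan)
  define f where "f x = (\<Sum>i<card S. Poly_Mapping.lookup x i *\<^sub>R h i)" for x
  have "linear f"
    by (rule linearI) (simp_all add: f_def lookup_add lookup_scaleR scaleR_add_left sum.distrib scaleR_sum_right)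
  moreover have "f ` cube (card S) = zon S"
  proof (intro equalityI subsetI)
    fix y assume "y \<in> f ` cube (card S)"
    then obtain x where x: "x \<in> cube (card S)" "y = f x" by blast
    let ?k = "inv_into {..<card S} h"
    have k: "?k u < card S" "h (?k u) = u" if "u \<in> S" for u
      using h that inv_into_into[of u h "{..<card S}"] by (auto simp: bij_betw_def f_inv_into_f)
    have "y = (\<Sum>u\<in>S. Poly_Mapping.lookup x (?k u) *\<^sub>R u)"
      unfolding x f_def using h
      by (subst sum.reindex_bij_betw[OF h, symmetric])
        (auto simp: bij_betw_def intro!: sum.cong)
    moreover have "\<forall>u\<in>S. \<bar>Poly_Mapping.lookup x (?k u)\<bar> \<le> 1" using x k by (auto simp: cube_def)
    ultimately show "y \<in> zon S" unfolding zon_def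
      by (intro CollectI exI[of _ "\<lambda>u. Poly_Mapping.lookup x (?k u)"] conjI)
  next
    fix y assume "y \<in> zon S"
    then obtain t where t: "\<forall>u\<in>S. \<bar>t u\<bar> \<le> 1" "y = (\<Sum>u\<in>S. t u *\<^sub>R u)" by (auto simp: zon_def)
    define x where "x = (\<Sum>i<card S. Poly_Mapping.single i (t (h i)))"
    have x: "Poly_Mapping.lookup x i = (if i < card S then t (h i) else 0)" for i
      by (auto simp: x_def lookup_sum lookup_single when_def)
    have "x \<in> cube (card S)"
      using h t by (auto simp: cube_def coord_space_iff x bij_betw_def)
    moreover have "f x = y"
      unfolding f_def t by (subst sum.reindex_bij_betw[OF h, symmetric]) (simp add: x)
    ultimately show "y \<in> f ` cube (card S)" by blast
  qed
  ultimately show thesis by (rule that)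
qed

section \<open>Dimension, faces and facets of the cube\<close>

lemma affine_dim_le:
  assumes "\<And>x y. x \<in> F \<Longrightarrow> y \<in> F \<Longrightarrow> x - y \<in> span W" "finite W"
  shows "affine_dim F \<le> card W"
  unfolding affine_dim_def using assms by (intro dim_le_card) auto

definition unit_vec :: "nat \<Rightarrow> (nat \<Rightarrow>\<^sub>0 real)" where
  "unit_vec i = Poly_Mapping.single i 1"

lemma lookup_unit_vec: "Poly_Mapping.lookup (unit_vec i) j = (if i = j then 1 else 0)"
  by (simp add: unit_vec_def lookup_single when_def)

lemma mem_span_unit_vec:
  assumes "finite I" "\<And>i. i \<notin> I \<Longrightarrow> Poly_Mapping.lookup x i = 0"
  shows "x \<in> span (unit_vec ` I)"
proof -
  have "x = (\<Sum>i\<in>I. Poly_Mapping.lookup x i *\<^sub>R unit_vec i)"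
    using assms by (intro poly_mapping_eqI)
      (auto simp: lookup_sum lookup_scaleR lookup_unit_vec if_distrib[of "\<lambda>r. _ * r"] cong: if_cong)
  also have "\<dots> \<in> span (unit_vec ` I)" by (intro span_sum span_scale span_base imageI)
  finally show ?thesis .
qed

lemma inj_unit_vec: "inj unit_vec"
  by (rule injI) (metis lookup_unit_vec zero_neq_one)

lemma independent_unit_vec:
  assumes "finite I"
  shows "independent (unit_vec ` I)"
proof (rule independent_if_scalars_zero)
  fix c x assume c: "(\<Sum>x\<in>unit_vec ` I. c x *\<^sub>R x) = 0" and "x \<in> unit_vec ` I"
  then obtain i where i: "i \<in> I" "x = unit_vec i" by blast
  have "(\<Sum>i\<in>I. c (unit_vec i) *\<^sub>R unit_vec i) = 0"
    using c inj_on_subset[OF inj_unit_vec] by (simp add: sum.reindex)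
  then have "Poly_Mapping.lookup (\<Sum>i\<in>I. c (unit_vec i) *\<^sub>R unit_vec i) i = 0" by simp
  then show "c x = 0" using i assms
    by (simp add: lookup_sum lookup_scaleR lookup_unit_vec if_distrib[of "\<lambda>r. _ * r"] cong: if_cong)
qed (use assms in simp)

lemma affine_dim_cube: "affine_dim (cube m) = m"
proof -
  let ?D = "{x - y |x y. x \<in> cube m \<and> y \<in> cube m}" and ?U = "unit_vec ` {..<m}"
  have "span ?U = span ?D"
    unfolding span_eq
  proof
    show "?U \<subseteq> span ?D"
    proof
      fix x assume "x \<in> ?U"
      then have "x \<in> cube m" "0 \<in> cube m" by (auto simp: cube_def coord_space_iff lookup_unit_vec)
      then have "x - 0 \<in> ?D" by blast
      then show "x \<in> span ?D" by (simp add: span_base)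
    qed
    show "?D \<subseteq> span ?U"
      by (auto simp: cube_def coord_space_iff lookup_minus intro!: mem_span_unit_vec) (metis leI)
  qed
  then show ?thesis
    unfolding affine_dim_def
    using dim_eq_card[of ?U ?D] independent_unit_vec[of "{..<m}"]
      card_image[OF inj_on_subset[OF inj_unit_vec subset_UNIV], of "{..<m}"] by simp
qed


text \<open>Call the condition that coordinate \<open>i\<close> equals \<open>s\<close>, with
  \<open>s\<close> either 1 or -1, a wall. Some \<open>y\<close> in \<open>F\<close> lies only on
  walls that contain all of \<open>F\<close>. If \<open>q\<close> lies on those walls too, the
  segment from \<open>q\<close> to \<open>y\<close> can be prolonged beyond \<open>y\<close> inside
  the cube, and the face property puts \<open>q\<close> into \<open>F\<close>.\<close>

lemma face_of_cube_mem:
  assumes F: "F face_of cube m" "F \<noteq> {}" and q: "q \<in> cube m"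
    and forced: "\<forall>i<m. \<forall>s. \<bar>s\<bar> = 1 \<longrightarrow> (\<forall>x\<in>F. Poly_Mapping.lookup x i = s) \<longrightarrow>
      Poly_Mapping.lookup q i = s"
  shows "q \<in> F"
proof -
  have F_cube: "\<bar>Poly_Mapping.lookup x i\<bar> \<le> 1" if "x \<in> F" "i < m" for x i
    using face_of_imp_subset[OF F(1)] that by (auto simp: cube_def)
  \<comment> \<open>The generic point \<open>y\<close> is built by induction over the walls to be
    avoided.\<close>
  have "\<exists>y\<in>F. \<forall>(i, s)\<in>P. (\<exists>x\<in>F. Poly_Mapping.lookup x i \<noteq> s) \<longrightarrow> Poly_Mapping.lookup y i \<noteq> s"
    if "finite P" "P \<subseteq> {..<m} \<times> {1, -1}" for P
    using that
  proof (induction P rule: finite_induct)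
    case empty
    then show ?case using F(2) by auto
  next
    case (insert p P)
    obtain i s where p: "p = (i, s)" by fastforce
    obtain y where y: "y \<in> F" and y2:
      "\<forall>(i, s)\<in>P. (\<exists>x\<in>F. Poly_Mapping.lookup x i \<noteq> s) \<longrightarrow> Poly_Mapping.lookup y i \<noteq> s"
      using insert by auto
    show ?case
    proof (cases "\<exists>x\<in>F. Poly_Mapping.lookup x i \<noteq> s")
      case False
      then show ?thesis using y y2 p by auto
    next
      case True
      then obtain x where x: "x \<in> F" "Poly_Mapping.lookup x i \<noteq> s" by blast
      \<comment> \<open>A midpoint of two points of the cube lies on a wall only if both points do,
        so \<open>?z\<close> avoids the new wall and all those avoided by \<open>y\<close>.\<close>
      let ?z = "(1/2) *\<^sub>R x + (1/2) *\<^sub>R y"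
      have "?z \<in> F" using face_of_imp_convex[OF F(1)] x y by (intro convexD) auto
      moreover have "Poly_Mapping.lookup ?z j \<noteq> t"
        if "j < m" "\<bar>t\<bar> = 1" "Poly_Mapping.lookup x j \<noteq> t \<or> Poly_Mapping.lookup y j \<noteq> t" for j t
      proof -
        have "Poly_Mapping.lookup ?z j = (Poly_Mapping.lookup x j + Poly_Mapping.lookup y j) / 2"
          by (simp add: lookup_add lookup_scaleR)
        moreover have "t = 1 \<or> t = -1" using that(2) by linarith
        moreover have "a \<le> 1 \<Longrightarrow> b \<le> 1 \<Longrightarrow> (a + b) / 2 = 1 \<Longrightarrow> a = 1 \<and> b = 1"
          "-1 \<le> a \<Longrightarrow> -1 \<le> b \<Longrightarrow> (a + b) / 2 = -1 \<Longrightarrow> a = -1 \<and> b = -1" for a b :: real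
          by auto
        ultimately show ?thesis
          using that(3) F_cube[OF x(1) that(1)] F_cube[OF y that(1)] by (metis abs_le_iff minus_le_iff)
      qed
      moreover have "Poly_Mapping.lookup x j \<noteq> t \<or> Poly_Mapping.lookup y j \<noteq> t"
        if "(j, t) \<in> insert p P" "\<exists>x\<in>F. Poly_Mapping.lookup x j \<noteq> t" for j t
        using that x(2) y2 p by fastforce
      moreover have "j < m \<and> \<bar>t\<bar> = 1" if "(j, t) \<in> insert p P" for j t
        using that insert.prems by auto
      ultimately show ?thesis by blast
    qed
  qed
  from this[of "{..<m} \<times> {1, -1}"] obtain y where y0: "y \<in> F"
    "\<forall>(i, s)\<in>{..<m} \<times> {1, -1}. (\<exists>x\<in>F. Poly_Mapping.lookup x i \<noteq> s) \<longrightarrow> Poly_Mapping.lookup y i \<noteq> s"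
    by auto
  note y = y0(1)
  have unforced: "\<exists>x\<in>F. Poly_Mapping.lookup x i \<noteq> s \<Longrightarrow> Poly_Mapping.lookup y i \<noteq> s"
    if "i < m" "\<bar>s\<bar> = 1" for i s
  proof -
    have "s = 1 \<or> s = -1" using that(2) by linarith
    then show "\<exists>x\<in>F. Poly_Mapping.lookup x i \<noteq> s \<Longrightarrow> Poly_Mapping.lookup y i \<noteq> s"
      using y0(2) that(1) by blast
  qed
  \<comment> \<open>One \<open>e\<close> for all coordinates that have slack at \<open>y\<close>.
    The factor 2 is there because coordinates of \<open>y\<close> and \<open>q\<close> differ by at
    most 2.\<close>
  have "\<exists>e>0. \<forall>i<k. \<bar>Poly_Mapping.lookup y i\<bar> < 1 \<longrightarrow> 2 * e \<le> 1 - \<bar>Poly_Mapping.lookup y i\<bar>" for k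
  proof (induction k)
    case (Suc k)
    then obtain e where e: "e > 0" "\<forall>i<k. \<bar>Poly_Mapping.lookup y i\<bar> < 1 \<longrightarrow> 2 * e \<le> 1 - \<bar>Poly_Mapping.lookup y i\<bar>"
      by blast
    let ?d = "if \<bar>Poly_Mapping.lookup y k\<bar> < 1 then (1 - \<bar>Poly_Mapping.lookup y k\<bar>) / 2 else 1"
    have "min e ?d > 0" using e by auto
    moreover have "\<bar>Poly_Mapping.lookup y i\<bar> < 1 \<longrightarrow> 2 * min e ?d \<le> 1 - \<bar>Poly_Mapping.lookup y i\<bar>" if "i < Suc k" for i
    proof (cases "i = k")
      case False
      then have "i < k" using that by simp
      moreover have "min e ?d \<le> e" by simp
      ultimately show ?thesis using e(2) by fastforce
    qed (simp add: min_def)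
    ultimately show ?case by blast
  qed (auto intro: exI[of _ 1])
  then obtain e where e: "e > 0"
    "\<And>i. i < m \<Longrightarrow> \<bar>Poly_Mapping.lookup y i\<bar> < 1 \<Longrightarrow> 2 * e \<le> 1 - \<bar>Poly_Mapping.lookup y i\<bar>" by meson
  define q' where "q' = y + e *\<^sub>R (y - q)"
  have "y \<in> cube m" using y face_of_imp_subset[OF F(1)] by auto
  have "\<bar>Poly_Mapping.lookup q' i\<bar> \<le> 1" if i: "i < m" for i
  proof (cases "\<bar>Poly_Mapping.lookup y i\<bar> < 1")
    case True
    have "\<bar>Poly_Mapping.lookup q i\<bar> \<le> 1" using q i by (simp add: cube_def)
    then have "\<bar>Poly_Mapping.lookup y i - Poly_Mapping.lookup q i\<bar> \<le> 2" using True by linarith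
    then have "\<bar>e * (Poly_Mapping.lookup y i - Poly_Mapping.lookup q i)\<bar> \<le> 2 * e"
      using e(1) by (simp add: abs_mult)
    then show ?thesis using e(2)[OF i True]
      by (simp add: q'_def lookup_add lookup_scaleR lookup_minus)
  next
    case False
    \<comment> \<open>By the choice of \<open>y\<close> this wall contains all of \<open>F\<close>,
      so \<open>q\<close> lies on it and the coordinate is constant along the line.\<close>
    then have "\<bar>Poly_Mapping.lookup y i\<bar> = 1" using F_cube[OF y i] by simp
    then have "Poly_Mapping.lookup q i = Poly_Mapping.lookup y i" using forced i unforced by blast
    then show ?thesis using F_cube[OF y i] by (simp add: q'_def lookup_add lookup_scaleR lookup_minus)
  qed
  then have q': "q' \<in> cube m"
    using q \<open>y \<in> cube m\<close> by (auto simp: cube_def coord_space_iff q'_def lookup_add lookup_scaleR lookup_minus)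
  show ?thesis
  proof (cases "q = y")
    case False
    have "y \<in> open_segment q q'"
      unfolding in_segment
    proof (intro conjI exI)
      show "q \<noteq> q'"
      proof
        assume "q = q'"
        then have "(1 + e) *\<^sub>R (y - q) = 0" by (simp add: q'_def algebra_simps)
        then show False using e False by simp
      qed
      have "y - q = (1 / (1 + e)) *\<^sub>R ((1 + e) *\<^sub>R (y - q))" using e by simp
      also have "(1 + e) *\<^sub>R (y - q) = q' - q" by (simp add: q'_def algebra_simps)
      finally show "y = (1 - 1 / (1 + e)) *\<^sub>R q + (1 / (1 + e)) *\<^sub>R q'" by (simp add: algebra_simps)
    qed (use e in auto)
    then show ?thesis using face_ofD[OF F(1) _ q q' y] by blast
  qed (use y in simp)
qed

text \<open>A facet misses some point of the cube, so by \<open>face_of_cube_mem\<close> it lies on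
  a wall. On a second wall its dimension would drop by 2. Hence it is the whole intersection of the
  cube with one of the \<open>2 * m\<close> walls.\<close>

lemma card_facets_cube: "card (facets (cube m)) \<le> 2 * m"
proof -
  define G where "G = (\<lambda>(i, s). {x \<in> cube m. Poly_Mapping.lookup x i = s})"
  have "facets (cube m) \<subseteq> G ` ({..<m} \<times> {1, -1})"
  proof
    fix F assume "F \<in> facets (cube m)"
    then have F: "F face_of cube m" "F \<noteq> {}" "affine_dim F + 1 = m"
      by (auto simp: facets_def affine_dim_cube)
    have sub: "F \<subseteq> cube m" using face_of_imp_subset[OF F(1)] .
    have "F \<noteq> cube m"
    proof
      assume "F = cube m"
      then have "affine_dim F = m" by (simp only: affine_dim_cube)
      then show False using F(3) by linarith
    qed
    then obtain q where "q \<in> cube m" "q \<notin> F" using sub by blast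
    then obtain i s where si: "i < m" "\<bar>s\<bar> = 1" "\<forall>x\<in>F. Poly_Mapping.lookup x i = s"
      using face_of_cube_mem[OF F(1,2)] by blast
    have only: "j = i \<and> t = s" if j: "j < m" "\<forall>x\<in>F. Poly_Mapping.lookup x j = t" for j t
    proof (rule ccontr)
      assume ne: "\<not> (j = i \<and> t = s)"
      have "j \<noteq> i" using ne si(3) j(2) F(2) by auto
      have "affine_dim F \<le> card (unit_vec ` ({..<m} - {i, j}))"
      proof (rule affine_dim_le)
        fix x y assume xy: "x \<in> F" "y \<in> F"
        then have "Poly_Mapping.lookup x k = Poly_Mapping.lookup y k" if "k \<notin> {..<m} - {i, j}" for k
          using that si(3) j(2) sub by (cases "k < m") (auto simp: cube_def coord_space_iff subset_iff)
        then show "x - y \<in> span (unit_vec ` ({..<m} - {i, j}))"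
          by (intro mem_span_unit_vec) (auto simp: lookup_minus)
      qed simp
      also have "\<dots> \<le> card ({..<m} - {i, j})" by (intro card_image_le) simp
      also have "\<dots> = m - 2" using si(1) j(1) \<open>j \<noteq> i\<close> by (subst card_Diff_subset) auto
      finally show False using F(3) si(1) j(1) \<open>j \<noteq> i\<close> by linarith
    qed
    have "F = G (i, s)"
    proof
      show "F \<subseteq> G (i, s)" using sub si(3) by (auto simp: G_def)
      show "G (i, s) \<subseteq> F"
        using only by (auto simp: G_def intro!: face_of_cube_mem[OF F(1,2)])
    qed
    moreover have "s \<in> {1, -1}" using si(2) by (auto simp: abs_if split: if_splits)
    ultimately show "F \<in> G ` ({..<m} \<times> {1, -1})" using si(1) by blast
  qed
  then have "card (facets (cube m)) \<le> card (G ` ({..<m} \<times> {1, -1}))" by (intro card_mono) auto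
  also have "\<dots> \<le> card ({..<m} \<times> {1 :: real, -1})" by (intro card_image_le) auto
  also have "\<dots> = 2 * m" by (simp add: card_cartesian_product)
  finally show ?thesis .
qed

lemma extension_complexity_zon_le:
  assumes "finite S"
  shows "extension_complexity (zon S) \<le> enat (2 * card S)"
proof -
  obtain f :: "(nat \<Rightarrow>\<^sub>0 real) \<Rightarrow> real ^ 'a" where "linear f" "f ` cube (card S) = zon S"
    using zon_eq_linear_image_cube[OF assms] by blast
  then have "extension_complexity (zon S) \<le> enat (card (facets (cube (card S))))"
    unfolding extension_complexity_def using polyhedron_in_cube by (intro Inf_lower) blast
  also have "\<dots> \<le> enat (2 * card S)" using card_facets_cube by simp
  finally show ?thesis .
qed

subsection \<open>Slopes in a Voronoi tiling whose cell has long chords\<close>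

text \<open>A discrete subgroup with bounded Voronoi cell; for the lattice in question the bound
  comes from the cell being a zonotope.\<close>

locale bounded_cell =
  fixes L :: "(real ^ 'n) set"
  assumes zero: "0 \<in> L"
    and add: "x \<in> L \<Longrightarrow> y \<in> L \<Longrightarrow> x + y \<in> L"
    and diff: "x \<in> L \<Longrightarrow> y \<in> L \<Longrightarrow> x - y \<in> L"
    and discrete: "finite {z \<in> L. norm z \<le> r}"
    and bdd: "bounded (voronoi_cell L)"
begin

lemma uminus: "x \<in> L \<Longrightarrow> - x \<in> L"
  using diff[OF zero] by simp

text \<open>Translation by \<open>z\<close> permutes \<open>L\<close>. So the tile of
  \<open>z\<close> consists of the points of the span that have \<open>z\<close> as a nearest
  lattice point.\<close>

lemma tile_iff:
  assumes "z \<in> L"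
  shows "x - z \<in> voronoi_cell L \<longleftrightarrow> x \<in> span L \<and> (\<forall>w\<in>L. norm (x - z) \<le> norm (x - w))"
proof -
  have "x - z \<in> span L \<longleftrightarrow> x \<in> span L"
    using span_add_eq2[OF span_base[OF assms], of "x - z"] by simp
  moreover have "(\<forall>w\<in>L. norm (x - z) \<le> norm (x - z - w)) \<longleftrightarrow> (\<forall>w\<in>L. norm (x - z) \<le> norm (x - w))"
  proof (intro iffI ballI)
    fix w assume "\<forall>w\<in>L. norm (x - z) \<le> norm (x - z - w)" "w \<in> L"
    then have "norm (x - z) \<le> norm (x - z - (w - z))" using diff assms by blast
    then show "norm (x - z) \<le> norm (x - w)" by simp
  next
    fix w assume "\<forall>w\<in>L. norm (x - z) \<le> norm (x - w)" "w \<in> L"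
    then have "norm (x - z) \<le> norm (x - (z + w))" using add assms by blast
    then show "norm (x - z) \<le> norm (x - z - w)" by (simp add: algebra_simps)
  qed
  ultimately show ?thesis by (simp add: voronoi_cell_def)
qed

text \<open>A nearest lattice point exists, because only finitely many are at least as near to
  \<open>x\<close> as 0 is.\<close>

lemma exists_tile:
  assumes "x \<in> span L"
  shows "\<exists>z\<in>L. x - z \<in> voronoi_cell L"
proof -
  let ?A = "{z \<in> L. norm (x - z) \<le> norm x}"
  have "norm z \<le> 2 * norm x" if "norm (x - z) \<le> norm x" for z
    using norm_triangle_ineq4[of x "x - z"] that by simp
  then have "?A \<subseteq> {z \<in> L. norm z \<le> 2 * norm x}" by blast
  then have "finite ?A" using discrete finite_subset by blast
  moreover have "0 \<in> ?A" using zero by simp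
  ultimately obtain z where "is_arg_min (\<lambda>z. norm (x - z)) (\<lambda>z. z \<in> ?A) z"
    using ex_is_arg_min_if_finite[of ?A "\<lambda>z. norm (x - z)"] by blast
  then have z: "z \<in> ?A" "\<And>w. w \<in> ?A \<Longrightarrow> norm (x - z) \<le> norm (x - w)"
    unfolding is_arg_min_linorder by blast+
  have "norm (x - z) \<le> norm (x - w)" if "w \<in> L" for w
    using z that by (cases "w \<in> ?A") auto
  then show ?thesis using tile_iff z(1) assms by blast
qed

lemma voronoi_cell_uminus:
  assumes "x \<in> voronoi_cell L"
  shows "- x \<in> voronoi_cell L"
proof -
  have "norm (- x) \<le> norm (- x - z)" if "z \<in> L" for z
  proof -
    have "norm x \<le> norm (x - (- z))" using assms uminus[OF that] unfolding voronoi_cell_def by blast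
    then show ?thesis using norm_minus_cancel[of "x + z"] by simp
  qed
  then show ?thesis using assms by (simp add: voronoi_cell_def span_neg)
qed

lemma closed_voronoi_cell: "closed (voronoi_cell L)"
proof -
  have "voronoi_cell L = span L \<inter> (\<Inter>z\<in>L. {x. norm x \<le> norm (x - z)})"
    by (auto simp: voronoi_cell_def)
  also have "closed \<dots>"
    by (intro closed_Int closed_INT ballI closed_Collect_le continuous_intros)
      (simp add: closed_subspace)
  finally show ?thesis .
qed

text \<open>The centres \<open>z n\<close> stay bounded, so by discreteness one of them occurs
  infinitely often, and its tile is closed.\<close>

lemma tile_limit:
  assumes lim: "y \<longlonglongrightarrow> l" and z: "\<And>n. z n \<in> L" "\<And>n. y n - z n \<in> voronoi_cell L"
  shows "\<exists>n. l - z n \<in> voronoi_cell L"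
proof -
  obtain A where A: "\<And>n. norm (y n) \<le> A"
    using convergent_imp_bounded[OF lim] by (auto simp: bounded_iff)
  obtain B where B: "\<And>x. x \<in> voronoi_cell L \<Longrightarrow> norm x \<le> B"
    using bdd by (auto simp: bounded_iff)
  have "norm (z n) \<le> A + B" for n
    using norm_triangle_ineq4[of "y n" "y n - z n"] A[of n] B[OF z(2)[of n]] by simp
  then have "range z \<subseteq> {z \<in> L. norm z \<le> A + B}" using z(1) by auto
  then have "finite (range z)" using discrete finite_subset by blast
  then obtain k where "infinite {n \<in> UNIV. z n = z k}"
    using pigeonhole_infinite[of "UNIV :: nat set" z] by auto
  then obtain r :: "nat \<Rightarrow> nat" where r: "strict_mono r" "\<And>n. z (r n) = z k"
    using infinite_enumerate[of "{n. z n = z k}"] by auto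
  have l: "(\<lambda>n. y (r n) - z k) \<longlonglongrightarrow> l - z k"
    using tendsto_diff[OF LIMSEQ_subseq_LIMSEQ[OF lim r(1)] tendsto_const, of "z k"] by (simp add: o_def)
  have "l - z k \<in> voronoi_cell L"
    using z(2)[of "r _"] r(2) by (intro closed_sequentially[OF closed_voronoi_cell _ l]) simp
  then show ?thesis ..
qed

text \<open>Adding the two nearest-point inequalities cancels all quadratic terms. This is the
  monotonicity of the slope of a convex function along a line.\<close>

lemma slope_le:
  assumes z: "z \<in> L" "w \<in> L" and "y - z \<in> voronoi_cell L" "y + t *\<^sub>R g - w \<in> voronoi_cell L"
  shows "t * (g \<bullet> z) \<le> t * (g \<bullet> w)"
proof -
  have "norm (y - z) \<le> norm (y - w)" using assms tile_iff by blast
  moreover have "norm (y + t *\<^sub>R g - w) \<le> norm (y + t *\<^sub>R g - z)" using assms tile_iff by blast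
  ultimately have "(y - z) \<bullet> (y - z) + (y + t *\<^sub>R g - w) \<bullet> (y + t *\<^sub>R g - w)
      \<le> (y - w) \<bullet> (y - w) + (y + t *\<^sub>R g - z) \<bullet> (y + t *\<^sub>R g - z)"
    by (simp add: norm_le add_mono)
  then show ?thesis
    by (simp add: inner_diff_left inner_diff_right inner_add_left inner_add_right inner_commute)
qed

lemma slope_eq:
  assumes "z \<in> L" "w \<in> L" "t \<noteq> 0" "y - z \<in> voronoi_cell L" "y - w \<in> voronoi_cell L"
    "y + t *\<^sub>R g - z \<in> voronoi_cell L" "y + t *\<^sub>R g - w \<in> voronoi_cell L"
  shows "g \<bullet> z = g \<bullet> w"
proof -
  have "t * (g \<bullet> z) = t * (g \<bullet> w)" 
    by (intro antisym slope_le) (use assms in auto)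
  with \<open>t \<noteq> 0\<close> show ?thesis by simp
qed

end

section \<open>Slopes in the direction of one generator\<close>

locale bounded_cell_chords = bounded_cell L for L :: "(real ^ 'n) set" +
  fixes g :: "real ^ 'n"
  assumes g: "g \<noteq> 0" "g \<in> span L" and chords: "has_chords (voronoi_cell L) g"
begin

lemma tile_chord:
  assumes "y - z \<in> voronoi_cell L"
  obtains b where "0 \<le> b" "b \<le> 2" "\<And>t. - b \<le> t \<Longrightarrow> t \<le> 2 - b \<Longrightarrow> y + t *\<^sub>R g - z \<in> voronoi_cell L"
proof -
  obtain b where b: "b \<in> {0..2}" "\<forall>t\<in>{- b..2 - b}. y - z + t *\<^sub>R g \<in> voronoi_cell L"
    using chords assms unfolding has_chords_def by blast
  moreover have "y - z + t *\<^sub>R g = y + t *\<^sub>R g - z" for t by simp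
  ultimately show thesis using that by auto
qed

text \<open>The name comes from the convex function \<open>x \<mapsto> Max {2 * (x \<bullet> z) - z \<bullet> z | z. z \<in> L}\<close>: it is
  affine on the tile of \<open>z\<close>, with derivative \<open>2 * (g \<bullet> z)\<close> in direction \<open>g\<close>.\<close>

definition slope_on_line :: "real \<Rightarrow> real ^ 'n \<Rightarrow> bool" where
  "slope_on_line c x \<longleftrightarrow> (\<exists>z\<in>L. \<exists>t. g \<bullet> z = c \<and> x + t *\<^sub>R g - z \<in> voronoi_cell L)"

text \<open>The cell is bounded, so the components of \<open>x + t g\<close> and \<open>z\<close>
  along \<open>g\<close> differ by a bounded amount. This gives compactness of the shifts
  \<open>t\<close>.\<close>

lemma slope_shift_bound:
  obtains B where "\<And>x t z. x + t *\<^sub>R g - z \<in> voronoi_cell L \<Longrightarrow> \<bar>t\<bar> * (g \<bullet> g) \<le> B + \<bar>g \<bullet> x\<bar> + \<bar>g \<bullet> z\<bar>"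
proof -
  obtain B where B: "\<And>x. x \<in> voronoi_cell L \<Longrightarrow> norm x \<le> B"
    using bdd by (auto simp: bounded_iff)
  have "\<bar>t\<bar> * (g \<bullet> g) \<le> norm g * B + \<bar>g \<bullet> x\<bar> + \<bar>g \<bullet> z\<bar>" if "x + t *\<^sub>R g - z \<in> voronoi_cell L" for x t z
  proof -
    have "\<bar>g \<bullet> (x + t *\<^sub>R g - z)\<bar> \<le> norm g * norm (x + t *\<^sub>R g - z)" by (rule Cauchy_Schwarz_ineq2)
    also have "\<dots> \<le> norm g * B" by (intro mult_left_mono B that) simp
    finally have "\<bar>g \<bullet> x + t * (g \<bullet> g) - g \<bullet> z\<bar> \<le> norm g * B"
      by (simp add: inner_diff_right inner_add_right)
    then have "\<bar>t * (g \<bullet> g)\<bar> \<le> norm g * B + \<bar>g \<bullet> x\<bar> + \<bar>g \<bullet> z\<bar>" by linarith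
    then show ?thesis by (simp add: abs_mult)
  qed
  then show thesis by (rule that)
qed

text \<open>The slope \<open>c\<close> is fixed, so the shifts \<open>t n\<close> are bounded; along
  a subsequence they converge and \<open>tile_limit\<close> applies.\<close>

lemma slope_on_line_limit:
  assumes lim: "x \<longlonglongrightarrow> l" and x: "\<And>n. slope_on_line c (x n)"
  shows "slope_on_line c l"
proof -
  have "\<forall>n. \<exists>z t. z \<in> L \<and> g \<bullet> z = c \<and> x n + t *\<^sub>R g - z \<in> voronoi_cell L"
    using x unfolding slope_on_line_def by blast
  then obtain z t where "\<forall>n. z n \<in> L \<and> g \<bullet> z n = c \<and> x n + t n *\<^sub>R g - z n \<in> voronoi_cell L"
    by metis
  then have zt: "\<And>n. z n \<in> L" "\<And>n. g \<bullet> z n = c" "\<And>n. x n + t n *\<^sub>R g - z n \<in> voronoi_cell L"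
    by blast+
  obtain B where B: "\<And>x t z. x + t *\<^sub>R g - z \<in> voronoi_cell L \<Longrightarrow> \<bar>t\<bar> * (g \<bullet> g) \<le> B + \<bar>g \<bullet> x\<bar> + \<bar>g \<bullet> z\<bar>"
    using slope_shift_bound by blast
  obtain A where A: "\<And>n. norm (x n) \<le> A"
    using convergent_imp_bounded[OF lim] by (auto simp: bounded_iff)
  have "\<bar>t n\<bar> \<le> (B + norm g * A + \<bar>c\<bar>) / (g \<bullet> g)" for n
  proof -
    have "\<bar>g \<bullet> x n\<bar> \<le> norm g * norm (x n)" by (rule Cauchy_Schwarz_ineq2)
    also have "\<dots> \<le> norm g * A" by (intro mult_left_mono A) simp
    finally have "\<bar>t n\<bar> * (g \<bullet> g) \<le> B + norm g * A + \<bar>c\<bar>" using B[OF zt(3)[of n]] zt(2) by simp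
    then show ?thesis using g by (simp add: pos_le_divide_eq)
  qed
  then have "bounded (range t)" by (auto simp: bounded_iff)
  then obtain s r where r: "strict_mono r" "(t \<circ> r) \<longlonglongrightarrow> s" using bounded_imp_convergent_subsequence by blast
  have "(\<lambda>n. x (r n) + t (r n) *\<^sub>R g) \<longlonglongrightarrow> l + s *\<^sub>R g"
    using tendsto_add[OF LIMSEQ_subseq_LIMSEQ[OF lim r(1)] tendsto_scaleR[OF r(2) tendsto_const, of g]]
    by (simp add: o_def)
  from tile_limit[OF this, of "\<lambda>n. z (r n)"] zt show ?thesis unfolding slope_on_line_def by blast
qed

text \<open>On the limiting line a tile of slope \<open>c\<close> still has a chord of positive length, and every
  tile approaching its midpoint overlaps it in a segment, hence has the same slope.\<close>

lemma not_slope_on_line_limit: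
  assumes lim: "x \<longlonglongrightarrow> l" and x: "\<And>n. x n \<in> span L" "\<And>n. \<not> slope_on_line c (x n)"
  shows "\<not> slope_on_line c l"
proof
  assume "slope_on_line c l"
  then obtain z t where z: "z \<in> L" "g \<bullet> z = c" "l + t *\<^sub>R g - z \<in> voronoi_cell L"
    unfolding slope_on_line_def by blast
  obtain b where b: "0 \<le> b" "b \<le> 2"
    "\<And>s. - b \<le> s \<Longrightarrow> s \<le> 2 - b \<Longrightarrow> l + t *\<^sub>R g + s *\<^sub>R g - z \<in> voronoi_cell L"
    using tile_chord[OF z(3)] by blast
  \<comment> \<open>The midpoint of the chord, which leaves room for
    \<open>\<bar>s\<bar> \<le> 1\<close> on both sides.\<close>
  define y where "y = l + (t + (1 - b)) *\<^sub>R g"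
  have y: "y + s *\<^sub>R g - z \<in> voronoi_cell L" if "\<bar>s\<bar> \<le> 1" for s
    using b(3)[of "1 - b + s"] that by (simp add: y_def algebra_simps)
  have "x n + (t + (1 - b)) *\<^sub>R g \<in> span L" for n using x(1) g by (intro span_add span_scale)
  then have "\<forall>n. \<exists>v. v \<in> L \<and> x n + (t + (1 - b)) *\<^sub>R g - v \<in> voronoi_cell L"
    using exists_tile by blast
  from choice[OF this] obtain v
    where v: "\<And>n. v n \<in> L" "\<And>n. x n + (t + (1 - b)) *\<^sub>R g - v n \<in> voronoi_cell L" by blast
  have "(\<lambda>n. x n + (t + (1 - b)) *\<^sub>R g) \<longlonglongrightarrow> y" unfolding y_def by (intro tendsto_intros lim)
  from tile_limit[OF this v] obtain n where n: "y - v n \<in> voronoi_cell L" by blast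
  obtain a where a: "0 \<le> a" "a \<le> 2" "\<And>s. - a \<le> s \<Longrightarrow> s \<le> 2 - a \<Longrightarrow> y + s *\<^sub>R g - v n \<in> voronoi_cell L"
    using tile_chord[OF n] by blast
  \<comment> \<open>The chord through \<open>y\<close> of the tile of \<open>v n\<close> has
    parameter length 2, so it reaches -1 or 1.\<close>
  define s :: real where "s = (if a \<ge> 1 then -1 else 1)"
  have "g \<bullet> z = g \<bullet> v n"
  proof (rule slope_eq)
    show "y - z \<in> voronoi_cell L" using y[of 0] by simp
    show "y + s *\<^sub>R g - z \<in> voronoi_cell L" using y[of s] by (simp add: s_def)
    show "y + s *\<^sub>R g - v n \<in> voronoi_cell L" using a(3)[of s] a(1,2) by (simp add: s_def)
  qed (use z v n in \<open>auto simp: s_def\<close>)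
  then have "slope_on_line c (x n)" using v[of n] z(2) unfolding slope_on_line_def by auto
  with x(2) show False by blast
qed

text \<open>By the two limit lemmas the points whose line sees the slope form a closed set with
  closed complement in the connected \<open>span L\<close>, and \<open>w\<close> lies in its own
  tile.\<close>

lemma slope_on_every_line:
  assumes w: "w \<in> L" and "x \<in> span L"
  shows "slope_on_line (g \<bullet> w) x"
proof -
  let ?U = "{x \<in> span L. slope_on_line (g \<bullet> w) x}" and ?V = "{x \<in> span L. \<not> slope_on_line (g \<bullet> w) x}"
  have cl: "closed (span L)" by (simp add: closed_subspace)
  have "closed ?U" "closed ?V"
    unfolding closed_sequential_limits
    using slope_on_line_limit not_slope_on_line_limit closed_sequentially[OF cl] by blast+
  moreover have "connected (span L)" by (simp add: convex_connected subspace_imp_convex)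
  moreover have "w \<in> ?U"
  proof -
    have "w + 0 *\<^sub>R g - w \<in> voronoi_cell L" by (simp add: voronoi_cell_def span_zero)
    then show ?thesis using w span_base unfolding slope_on_line_def by blast
  qed
  ultimately have "?V = {}"
    unfolding connected_closed by blast
  then show ?thesis using assms(2) by blast
qed

text \<open>A tile whose slope lies strictly between the slopes of two tiles containing \<open>y\<close> would meet
  the line through \<open>y\<close> at \<open>y\<close> only, but its chord has positive length.\<close>

lemma slopes_consecutive:
  assumes "z \<in> L" "z' \<in> L" "y - z \<in> voronoi_cell L" "y - z' \<in> voronoi_cell L" "w \<in> L"
  shows "\<not> (g \<bullet> z < g \<bullet> w \<and> g \<bullet> w < g \<bullet> z')"
proof
  assume *: "g \<bullet> z < g \<bullet> w \<and> g \<bullet> w < g \<bullet> z'"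
  have "y \<in> span L" using assms tile_iff by blast
  then obtain v t where v: "v \<in> L" "g \<bullet> v = g \<bullet> w" "y + t *\<^sub>R g - v \<in> voronoi_cell L"
    using slope_on_every_line[OF \<open>w \<in> L\<close>] unfolding slope_on_line_def by metis
  have only0: "s = 0" if "y + s *\<^sub>R g - v \<in> voronoi_cell L" for s
  proof -
    \<comment> \<open>The first inequality excludes negative \<open>s\<close>, the second positive
      \<open>s\<close>.\<close>
    have "s * (g \<bullet> z) \<le> s * (g \<bullet> v)" "s * (g \<bullet> z') \<le> s * (g \<bullet> v)"
      using slope_le assms that v(1) by blast+
    then show ?thesis using * v(2) by (simp add: mult_le_cancel_left)
  qed
  then have "t = 0" using v by blast
  obtain b where b: "\<And>s. - b \<le> s \<Longrightarrow> s \<le> 2 - b \<Longrightarrow> y + s *\<^sub>R g - v \<in> voronoi_cell L"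
    using tile_chord[of y v] v \<open>t = 0\<close> by auto
  have "- b = 0" "2 - b = 0" by (intro only0 b; simp)+
  then show False by simp
qed

text \<open>Every slope already occurs on the line through 0. There a bounded slope forces a bounded
  shift and hence a bounded tile centre, and discreteness applies.\<close>

lemma finite_slopes: "finite {g \<bullet> w | w. w \<in> L \<and> \<bar>g \<bullet> w\<bar> \<le> r}"
proof -
  obtain B where B: "\<And>x t z. x + t *\<^sub>R g - z \<in> voronoi_cell L \<Longrightarrow> \<bar>t\<bar> * (g \<bullet> g) \<le> B + \<bar>g \<bullet> x\<bar> + \<bar>g \<bullet> z\<bar>"
    using slope_shift_bound by blast
  obtain C where C: "\<And>x. x \<in> voronoi_cell L \<Longrightarrow> norm x \<le> C"
    using bdd by (auto simp: bounded_iff)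
  define R where "R = (B + r) / (g \<bullet> g) * norm g + C"
  have "{g \<bullet> w | w. w \<in> L \<and> \<bar>g \<bullet> w\<bar> \<le> r} \<subseteq> (\<bullet>) g ` {z \<in> L. norm z \<le> R}"
  proof clarify
    fix w assume w: "w \<in> L" "\<bar>g \<bullet> w\<bar> \<le> r"
    obtain z t where z: "z \<in> L" "g \<bullet> z = g \<bullet> w" "0 + t *\<^sub>R g - z \<in> voronoi_cell L"
      using slope_on_every_line[OF w(1) span_zero] unfolding slope_on_line_def by metis
    have "\<bar>t\<bar> \<le> (B + r) / (g \<bullet> g)" using B[OF z(3)] z(2) w(2) g by (simp add: pos_le_divide_eq)
    then have "\<bar>t\<bar> * norm g \<le> (B + r) / (g \<bullet> g) * norm g" by (intro mult_right_mono) auto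
    moreover have "norm z \<le> norm (t *\<^sub>R g) + norm (t *\<^sub>R g - z)"
      using norm_triangle_ineq4[of "t *\<^sub>R g" "t *\<^sub>R g - z"] by simp
    ultimately have "norm z \<le> R" using C[OF z(3)] by (simp add: R_def)
    then show "g \<bullet> w \<in> (\<bullet>) g ` {z \<in> L. norm z \<le> R}" using z by (intro image_eqI[of _ _ z]) auto
  qed
  then show ?thesis using discrete finite_subset by blast
qed

lemma multiple_in_lattice: "w \<in> L \<Longrightarrow> real_of_int n *\<^sub>R w \<in> L"
proof (induction n rule: int_induct[of _ 0])
  case base
  then show ?case using zero by simp
next
  case (step1 i)
  then show ?case using add[of "real_of_int i *\<^sub>R w" w] by (simp add: algebra_simps)
next
  case (step2 i)
  then show ?case using diff[of "real_of_int i *\<^sub>R w" w] by (simp add: algebra_simps)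
qed

text \<open>\<open>c\<close> is the least positive slope, and division with remainder makes every
  slope a multiple of it. For reduced \<open>v\<close> neither \<open>c\<close> nor
  \<open>- c\<close> lies strictly between 0 and \<open>g \<bullet> v\<close>.\<close>

lemma slope_unit:
  obtains c where "c > 0" "\<And>w. w \<in> L \<Longrightarrow> g \<bullet> w / c \<in> \<int>" "\<exists>w\<in>L. g \<bullet> w = c"
    "\<And>v. v \<in> L \<Longrightarrow> (1/2) *\<^sub>R v \<in> voronoi_cell L \<Longrightarrow> \<bar>g \<bullet> v\<bar> \<le> c"
proof -
  have "\<exists>w\<in>L. g \<bullet> w \<noteq> 0"
  proof (rule ccontr)
    assume "\<not> ?thesis"
    then have "\<And>w. w \<in> L \<Longrightarrow> orthogonal g w" by (simp add: orthogonal_def)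
    then have "orthogonal g g" using orthogonal_to_span g(2) by metis
    then show False using g(1) by (simp add: orthogonal_def)
  qed
  then obtain w where w: "w \<in> L" "g \<bullet> w \<noteq> 0" by blast
  obtain w0 where w0: "w0 \<in> L" "g \<bullet> w0 > 0"
  proof (cases "g \<bullet> w > 0")
    case False
    then have "g \<bullet> (- w) > 0" using w by simp
    then show ?thesis using that uminus w by blast
  qed (use that w in blast)
  \<comment> \<open>Cutting off at the slope of \<open>w0\<close> makes the set finite, so that its
    minimum exists.\<close>
  define A where "A = {g \<bullet> w | w. w \<in> L \<and> \<bar>g \<bullet> w\<bar> \<le> g \<bullet> w0} \<inter> {0<..}"
  have fin: "finite A" unfolding A_def using finite_slopes by blast
  have A: "g \<bullet> w \<in> A" if "w \<in> L" "0 < g \<bullet> w" "g \<bullet> w \<le> g \<bullet> w0" for w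
    using that unfolding A_def by fastforce
  have w0A: "g \<bullet> w0 \<in> A" using A[OF w0] by simp
  then have "Min A \<in> A" using fin by (intro Min_in) auto
  then obtain w1 where w1: "w1 \<in> L" "Min A = g \<bullet> w1" "g \<bullet> w1 > 0" unfolding A_def by auto
  have min: "g \<bullet> w1 \<le> g \<bullet> w" if w: "w \<in> L" "g \<bullet> w > 0" for w
  proof (cases "g \<bullet> w \<le> g \<bullet> w0")
    case True
    then show ?thesis using Min_le[OF fin A[OF w]] w1(2) by simp
  next
    case False
    then show ?thesis using Min_le[OF fin w0A] w1(2) by simp
  qed
  show thesis
  proof (rule that[OF w1(3)])
    fix w assume w: "w \<in> L"
    define n where "n = \<lfloor>g \<bullet> w / (g \<bullet> w1)\<rfloor>"
    define v where "v = w - real_of_int n *\<^sub>R w1"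
    have v: "v \<in> L" unfolding v_def by (intro diff w multiple_in_lattice w1)
    have "real_of_int n \<le> g \<bullet> w / (g \<bullet> w1)" "g \<bullet> w / (g \<bullet> w1) < real_of_int n + 1"
      unfolding n_def by linarith+
    then have "0 \<le> g \<bullet> v" "g \<bullet> v < g \<bullet> w1"
      using w1(3) by (simp_all add: v_def inner_diff_right field_simps)
    with min[OF v] have "g \<bullet> v = 0" by force
    then have "g \<bullet> w / (g \<bullet> w1) = real_of_int n" using w1(3) by (simp add: v_def inner_diff_right)
    then show "g \<bullet> w / (g \<bullet> w1) \<in> \<int>" by simp
  next
    show "\<exists>w\<in>L. g \<bullet> w = g \<bullet> w1" using w1 by blast
  next
    fix v assume v: "v \<in> L" "(1/2) *\<^sub>R v \<in> voronoi_cell L"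
    \<comment> \<open>The midpoint \<open>v / 2\<close> belongs to the tiles of 0 and of
      \<open>v\<close>, whose slopes are 0 and \<open>g \<bullet> v\<close>.\<close>
    have 0: "(1/2) *\<^sub>R v - 0 \<in> voronoi_cell L" using v by simp
    have "(1/2) *\<^sub>R v - v = - ((1/2) *\<^sub>R v)" by (simp add: vec_eq_iff)
    then have 1: "(1/2) *\<^sub>R v - v \<in> voronoi_cell L" using voronoi_cell_uminus[OF v(2)] by (simp only:)
    have "\<not> (0 < g \<bullet> w1 \<and> g \<bullet> w1 < g \<bullet> v)" 
      using slopes_consecutive[OF zero v(1) 0 1 w1(1)] by simp
    moreover have "\<not> (g \<bullet> v < - (g \<bullet> w1) \<and> - (g \<bullet> w1) < 0)"
      using slopes_consecutive[OF v(1) zero 1 0 uminus[OF w1(1)]] by simp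
    ultimately show "\<bar>g \<bullet> v\<bar> \<le> g \<bullet> w1" using w1(3) by linarith
  qed
qed

end

text \<open>Take for \<open>z\<close> a lattice point nearest to \<open>w / 2\<close>.\<close>

lemma (in bounded_cell) exists_reduced:
  assumes "w \<in> L"
  shows "\<exists>z\<in>L. (1/2) *\<^sub>R (w - 2 *\<^sub>R z) \<in> voronoi_cell L"
proof -
  have "(1/2) *\<^sub>R w \<in> span L" using assms by (intro span_scale span_base)
  from exists_tile[OF this] show ?thesis by (simp add: scaleR_right_diff_distrib)
qed

subsection \<open>Independence of squares\<close>

lemma characters_independent:
  fixes ch :: "'b \<Rightarrow> 'a::monoid_add \<Rightarrow> real"
  assumes "finite U" "u \<in> U"
    and closed: "0 \<in> L" "\<And>x y. x \<in> L \<Longrightarrow> y \<in> L \<Longrightarrow> x + y \<in> L"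
    and one: "\<And>u. u \<in> U \<Longrightarrow> ch u 0 = 1"
    and mult: "\<And>u x y. u \<in> U \<Longrightarrow> x \<in> L \<Longrightarrow> y \<in> L \<Longrightarrow> ch u (x + y) = ch u x * ch u y"
    and distinct: "\<And>u v. u \<in> U \<Longrightarrow> v \<in> U \<Longrightarrow> u \<noteq> v \<Longrightarrow> \<exists>x\<in>L. ch u x \<noteq> ch v x"
    and rel: "\<And>x. x \<in> L \<Longrightarrow> (\<Sum>u\<in>U. m u * ch u x) = 0"
  shows "m u = 0"
  using assms(1,2) one mult distinct rel
proof (induction U arbitrary: m u rule: finite_induct)
  case empty
  then show ?case by simp
next
  case (insert v U)
  have U0: "m u = 0" if u: "u \<in> U" for u
  proof -
    obtain y where y: "y \<in> L" "ch u y \<noteq> ch v y"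
      using insert.prems(4)[of u v] u insert.hyps by auto
    have "m u * (ch u y - ch v y) = 0"
    proof (rule insert.IH[of u "\<lambda>u. m u * (ch u y - ch v y)"])
      fix x assume x: "x \<in> L"
      \<comment> \<open>Artin's argument: the relation at \<open>x + y\<close> minus
        \<open>ch v y\<close> times the relation at \<open>x\<close> has no term for
        \<open>v\<close>.\<close>
      have "(\<Sum>u\<in>insert v U. m u * ch u (x + y)) - ch v y * (\<Sum>u\<in>insert v U. m u * ch u x) = 0"
        using insert.prems(5) closed x y by simp
      then have "(\<Sum>u\<in>insert v U. m u * ch u (x + y) - ch v y * (m u * ch u x)) = 0"
        by (simp only: sum_subtractf sum_distrib_left)
      moreover have "(\<Sum>u\<in>insert v U. m u * ch u (x + y) - ch v y * (m u * ch u x)) =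
          (\<Sum>u\<in>insert v U. m u * (ch u y - ch v y) * ch u x)"
        using x y insert.prems(3) by (intro sum.cong refl) (simp add: algebra_simps)
      ultimately show "(\<Sum>u\<in>U. m u * (ch u y - ch v y) * ch u x) = 0"
        using insert.hyps by simp
    qed (use u insert.prems in auto)
    then show ?thesis using y by simp
  qed
  have "m v = 0"
    using insert.prems(5)[OF closed(1)] insert.prems(2)[of v] insert.hyps U0 by simp
  then show ?case using U0 insert.prems(1) by auto
qed

section \<open>Dimension of the space of quadratic forms\<close>

text \<open>These sets index the entries of a symmetric matrix: singletons the diagonal, pairs the
  rest.\<close>

lemma card_subsets_1_2:
  "2 * card {s :: 'n::finite set. card s = 1 \<or> card s = 2} = CARD('n) * (CARD('n) + 1)"
proof -
  have "{s :: 'n set. card s = 1 \<or> card s = 2} = {s. card s = 1} \<union> {s. card s = 2}" by auto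
  moreover have "card {s :: 'n set. card s = k} = CARD('n) choose k" for k
    using n_subsets[of "UNIV :: 'n set" k] by simp
  ultimately have "card {s :: 'n set. card s = 1 \<or> card s = 2} = CARD('n) + (CARD('n) choose 2)"
    by (simp, subst card_Un_disjoint) auto
  moreover have "2 * (CARD('n) choose 2) = CARD('n) * (CARD('n) - 1)"
    by (simp add: choose_two)
  moreover have "CARD('n) > 0" by simp
  ultimately show ?thesis by (cases "CARD('n)") (auto simp: algebra_simps)
qed

text \<open>The form \<open>(u \<bullet> x)\<close> squared belongs to the symmetric rank-one matrix
  \<open>M u\<close>. Independence of the forms passes to the matrices, which lie in the span of the
  \<open>E s\<close>.\<close>

lemma card_le_of_independent_squares:
  fixes U :: "(real ^ 'n) set"
  assumes "finite U"
    and indep: "\<And>m u. (\<And>x. (\<Sum>u\<in>U. m u * (u \<bullet> x)\<^sup>2) = 0) \<Longrightarrow> u \<in> U \<Longrightarrow> m u = 0"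
  shows "2 * card U \<le> CARD('n) * (CARD('n) + 1)"
proof -
  define M :: "real ^ 'n \<Rightarrow> real ^ 'n ^ 'n" where "M u = (\<chi> a b. u $ a * u $ b)" for u
  define E :: "'n set \<Rightarrow> real ^ 'n ^ 'n" where "E s = (\<chi> a b. if {a, b} = s then 1 else 0)" for s
  define S where "S = {s :: 'n set. card s = 1 \<or> card s = 2}"
  have Mq: "x \<bullet> (M u *v x) = (u \<bullet> x)\<^sup>2" for u x
  proof -
    have "M u *v x = (u \<bullet> x) *\<^sub>R u"
      by (simp add: M_def vec_eq_iff matrix_vector_mult_def inner_vec_def sum_distrib_left
          sum_distrib_right mult_ac)
    then show ?thesis by (simp add: power2_eq_square inner_commute)
  qed
  have lin: "x \<bullet> ((\<Sum>u\<in>U. m u *\<^sub>R M u) *v x) = (\<Sum>u\<in>U. m u * (u \<bullet> x)\<^sup>2)" for m x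
    using \<open>finite U\<close>
    by induction (auto simp: matrix_vector_mult_add_rdistrib inner_add_right Mq 
        simp flip: scaleR_matrix_vector_assoc)
  have inj: "inj_on M U"
  proof (rule inj_onI, rule ccontr)
    fix u v assume uv: "u \<in> U" "v \<in> U" "M u = M v" "u \<noteq> v"
    \<comment> \<open>If \<open>M u = M v\<close>, the coefficients 1 at \<open>u\<close> and -1 at
      \<open>v\<close> give a nontrivial relation.\<close>
    have "(\<Sum>w\<in>U. ((if w = u then 1 else 0) - (if w = v then 1 else 0)) * (w \<bullet> x)\<^sup>2) = 0" for x
      using Mq[of x u] Mq[of x v] uv \<open>finite U\<close>
      by (simp add: left_diff_distrib sum_subtractf if_distrib[of "\<lambda>r. r * _"] sum.delta cong: if_cong)
    from indep[OF this uv(1)] uv show False by simp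
  qed
  have "independent (M ` U)"
    unfolding independent_explicit
  proof (intro conjI allI impI ballI)
    fix c A assume c: "(\<Sum>A\<in>M ` U. c A *\<^sub>R A) = 0" and "A \<in> M ` U"
    then obtain u where u: "u \<in> U" "A = M u" by auto
    have "(\<Sum>u\<in>U. c (M u) *\<^sub>R M u) = 0" using c inj by (simp add: sum.reindex)
    then have "(\<Sum>u\<in>U. c (M u) * (u \<bullet> x)\<^sup>2) = 0" for x using lin[of x "\<lambda>u. c (M u)"] by simp
    from indep[OF this u(1)] show "c A = 0" using u by simp
  qed (simp add: \<open>finite U\<close>)
  moreover have "M ` U \<subseteq> span (E ` S)"
  proof
    fix A assume "A \<in> M ` U"
    then obtain u where A: "A = M u" by auto
    \<comment> \<open>For \<open>s = {a}\<close> the product has only one factor, so it is squared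
      to give the diagonal entry.\<close>
    define c where "c s = (if card s = 1 then (\<Prod>a\<in>s. u $ a)\<^sup>2 else (\<Prod>a\<in>s. u $ a))" for s
    have "A = (\<Sum>s\<in>S. c s *\<^sub>R E s)"
    proof -
      have "A $ a $ b = (\<Sum>s\<in>S. c s *\<^sub>R E s) $ a $ b" for a b
      proof -
        have "{a, b} \<in> S" by (auto simp: S_def card_insert_if)
        moreover have "c {a, b} = u $ a * u $ b"
          by (cases "a = b") (auto simp: c_def power2_eq_square)
        ultimately show ?thesis
          by (simp add: A M_def E_def if_distrib[of "\<lambda>r. _ * r"] sum.delta cong: if_cong)
      qed
      then show ?thesis by (simp add: vec_eq_iff)
    qed
    moreover have "(\<Sum>s\<in>S. c s *\<^sub>R E s) \<in> span (E ` S)"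
      by (intro span_sum span_scale span_base imageI)
    ultimately show "A \<in> span (E ` S)" by simp
  qed
  ultimately have "card (M ` U) \<le> card (E ` S)"
    using independent_span_bound[of "E ` S"] by simp
  also have "\<dots> \<le> card S" by (simp add: card_image_le)
  finally show ?thesis
    using card_subsets_1_2[where 'n='n] card_image[OF inj] unfolding S_def by simp
qed

section \<open>Functionals modulo 2\<close>

text \<open>Infinite descent: \<open>red\<close> gives
  \<open>l \<bullet> w = 2 * (l \<bullet> z)\<close>, so the integer \<open>l \<bullet> w\<close> is
  divisible by every power of 2.\<close>

lemma eq_0_if_vanishes_mod_2:
  fixes l :: "'a::real_inner"
  assumes "l \<in> span L" and int: "\<And>w. w \<in> L \<Longrightarrow> l \<bullet> w \<in> \<int>"
    and red: "\<And>w. w \<in> L \<Longrightarrow> \<exists>z\<in>L. l \<bullet> (w - 2 *\<^sub>R z) = 0"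
  shows "l = 0"
proof -
  have pow: "\<exists>z\<in>L. l \<bullet> w = 2 ^ n * (l \<bullet> z)" if "w \<in> L" for n w
    using that
  proof (induction n)
    case (Suc n)
    then obtain z where z: "z \<in> L" "l \<bullet> w = 2 ^ n * (l \<bullet> z)" by blast
    with red[of z] show ?case by (auto simp: inner_diff_right intro!: bexI)
  qed auto
  have "l \<bullet> w = 0" if w: "w \<in> L" for w
  proof (rule ccontr)
    assume nz: "l \<bullet> w \<noteq> 0"
    obtain n :: nat where n: "\<bar>l \<bullet> w\<bar> < 2 ^ n" using real_arch_pow[of 2] by auto
    obtain z where z: "z \<in> L" "l \<bullet> w = 2 ^ n * (l \<bullet> z)" using pow[OF w] by blast
    then have "\<bar>l \<bullet> z\<bar> \<ge> 1" using nz int by (intro Ints_nonzero_abs_ge1) auto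
    then have "\<bar>l \<bullet> w\<bar> \<ge> 2 ^ n" by (simp add: z abs_mult)
    with n show False by simp
  qed
  then have "\<And>w. w \<in> L \<Longrightarrow> orthogonal l w" by (simp add: orthogonal_def)
  then have "orthogonal l l" using orthogonal_to_span assms(1) by metis
  then show ?thesis by (simp add: orthogonal_def)
qed

text \<open>If \<open>u\<close> and \<open>v\<close> agree mod 2 then \<open>S = (u + v) / 2\<close> and \<open>T = (u - v) / 2\<close> are integral on
  \<open>L\<close>. They are never both odd, because a reduced vector in the same class would have
  \<open>S + T\<close> and \<open>S - T\<close> even, hence zero. So one of them is always even, hence zero on reduced
  vectors, hence zero.\<close>

lemma exists_parity_distinguishing:
  fixes u v :: "'a::real_inner"
  assumes "u \<in> span L" "v \<in> span L" "u \<noteq> v" "u \<noteq> - v"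
    and add: "\<And>x y. x \<in> L \<Longrightarrow> y \<in> L \<Longrightarrow> x + y \<in> L"
    and diff: "\<And>x y. x \<in> L \<Longrightarrow> y \<in> L \<Longrightarrow> x - y \<in> L"
    and int: "\<And>w. w \<in> L \<Longrightarrow> u \<bullet> w \<in> \<int>" "\<And>w. w \<in> L \<Longrightarrow> v \<bullet> w \<in> \<int>"
    and red: "\<And>w. w \<in> L \<Longrightarrow> \<exists>z\<in>L. \<bar>u \<bullet> (w - 2 *\<^sub>R z)\<bar> \<le> 1 \<and> \<bar>v \<bullet> (w - 2 *\<^sub>R z)\<bar> \<le> 1"
  shows "\<exists>w\<in>L. cos (pi * (u \<bullet> w)) \<noteq> cos (pi * (v \<bullet> w))"
proof (rule ccontr)
  assume "\<not> ?thesis"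
  then have same: "cos (pi * (u \<bullet> w)) = cos (pi * (v \<bullet> w))" if "w \<in> L" for w using that by auto
  define S T where "S = (1/2) *\<^sub>R (u + v)" and "T = (1/2) *\<^sub>R (u - v)"
  have ST: "\<exists>(a::int) (b::int). S \<bullet> w = a \<and> T \<bullet> w = b" if "w \<in> L" for w
  proof -
    from int(1)[OF that] int(2)[OF that]
    obtain a b :: int where ab: "u \<bullet> w = a" "v \<bullet> w = b" by (elim Ints_cases) blast
    \<comment> \<open>For integers \<open>a\<close> the cosine of \<open>pi * a\<close> is 1 or -1
      according to parity, so \<open>a\<close> and \<open>b\<close> have the same parity.\<close>
    then have "even (a + b)" "even (a - b)" 
      using same[OF that] by (auto simp: split: if_splits)
    then obtain c d where cd: "a + b = 2 * c" "a - b = 2 * d" by (elim evenE) blast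
    have "S \<bullet> w = of_int (a + b) / 2" "T \<bullet> w = of_int (a - b) / 2"
      by (simp_all add: S_def T_def inner_add_left inner_diff_left ab)
    then have "S \<bullet> w = c" "T \<bullet> w = d" unfolding cd by simp_all
    then show ?thesis by blast
  qed
  define p q where "p w = \<lfloor>S \<bullet> w\<rfloor>" and "q w = \<lfloor>T \<bullet> w\<rfloor>" for w
  have p: "S \<bullet> w = p w" and q: "T \<bullet> w = q w" if "w \<in> L" for w
  proof -
    from ST[OF that] obtain a b :: int where "S \<bullet> w = a" "T \<bullet> w = b" by blast
    then show "S \<bullet> w = p w" "T \<bullet> w = q w" by (simp_all add: p_def q_def)
  qed
  have p_add: "p (x + y) = p x + p y" and q_add: "q (x + y) = q x + q y" if "x \<in> L" "y \<in> L" for x y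
    using p[of x] p[of y] p[of "x + y"] q[of x] q[of y] q[of "x + y"] add[of x y] that
    by (simp_all add: inner_add_right flip: of_int_add)
  have red': "\<exists>z\<in>L. w - 2 *\<^sub>R z \<in> L \<and> p (w - 2 *\<^sub>R z) = p w - 2 * p z \<and> q (w - 2 *\<^sub>R z) = q w - 2 * q z
    \<and> \<bar>p (w - 2 *\<^sub>R z) + q (w - 2 *\<^sub>R z)\<bar> \<le> 1 \<and> \<bar>p (w - 2 *\<^sub>R z) - q (w - 2 *\<^sub>R z)\<bar> \<le> 1" if w: "w \<in> L" for w
  proof -
    obtain z where z: "z \<in> L" "\<bar>u \<bullet> (w - 2 *\<^sub>R z)\<bar> \<le> 1" "\<bar>v \<bullet> (w - 2 *\<^sub>R z)\<bar> \<le> 1"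
      using red[OF w] by blast
    let ?x = "w - 2 *\<^sub>R z"
    have x: "?x \<in> L" using diff[OF diff[OF w z(1)] z(1)] by (simp add: scaleR_2 algebra_simps)
    have "real_of_int (p ?x) = real_of_int (p w - 2 * p z)"
      using p[OF x] p[OF w] p[OF z(1)] by (simp add: inner_diff_right)
    moreover have "real_of_int (q ?x) = real_of_int (q w - 2 * q z)"
      using q[OF x] q[OF w] q[OF z(1)] by (simp add: inner_diff_right)
    moreover have "u \<bullet> ?x = real_of_int (p ?x + q ?x)" "v \<bullet> ?x = real_of_int (p ?x - q ?x)"
      unfolding of_int_add of_int_diff p[OF x, symmetric] q[OF x, symmetric]
      by (simp_all add: S_def T_def inner_add_left inner_diff_left add_divide_distrib diff_divide_distrib)
    ultimately show ?thesis using z x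
      by (metis of_int_1_le_iff of_int_abs of_int_eq_iff of_int_le_1_iff)
  qed
  have "\<not> (odd (p w) \<and> odd (q w))" if "w \<in> L" for w
  proof -
    from red'[OF that] obtain z where "p (w - 2 *\<^sub>R z) = p w - 2 * p z" "q (w - 2 *\<^sub>R z) = q w - 2 * q z"
      "\<bar>p (w - 2 *\<^sub>R z) + q (w - 2 *\<^sub>R z)\<bar> \<le> 1" "\<bar>p (w - 2 *\<^sub>R z) - q (w - 2 *\<^sub>R z)\<bar> \<le> 1" by blast
    then show ?thesis by presburger
  qed
  \<comment> \<open>A group is not the union of two proper subgroups: if \<open>p\<close> is odd at
    \<open>x\<close> and \<open>q\<close> odd at \<open>y\<close>, both are odd at
    \<open>x + y\<close>.\<close>
  then have "(\<forall>w\<in>L. even (p w)) \<or> (\<forall>w\<in>L. even (q w))"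
    using p_add q_add add by (metis even_add)
  then consider "\<forall>w\<in>L. even (p w)" | "\<forall>w\<in>L. even (q w)" by blast
  then show False
  proof cases
    case 1
    have "S = 0"
    proof (rule eq_0_if_vanishes_mod_2)
      show "\<exists>z\<in>L. S \<bullet> (w - 2 *\<^sub>R z) = 0" if w: "w \<in> L" for w
      proof -
        obtain z where z: "z \<in> L" "w - 2 *\<^sub>R z \<in> L"
          "\<bar>p (w - 2 *\<^sub>R z) + q (w - 2 *\<^sub>R z)\<bar> \<le> 1" "\<bar>p (w - 2 *\<^sub>R z) - q (w - 2 *\<^sub>R z)\<bar> \<le> 1"
          using red'[OF w] by blast
        moreover have "even (p (w - 2 *\<^sub>R z))" using 1 z by blast
        \<comment> \<open>The two bounds give absolute value at most 1, and evenness leaves only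
          0.\<close>
        ultimately have "p (w - 2 *\<^sub>R z) = 0" by presburger
        then show ?thesis using p[OF z(2)] z(1) by (intro bexI[of _ z]) simp_all
      qed
    qed (use assms(1,2) p in \<open>auto simp: S_def intro!: span_scale span_add\<close>)
    then show False using assms(4) by (simp add: S_def eq_neg_iff_add_eq_0)
  next
    case 2
    have "T = 0"
    proof (rule eq_0_if_vanishes_mod_2)
      show "\<exists>z\<in>L. T \<bullet> (w - 2 *\<^sub>R z) = 0" if w: "w \<in> L" for w
      proof -
        obtain z where z: "z \<in> L" "w - 2 *\<^sub>R z \<in> L"
          "\<bar>p (w - 2 *\<^sub>R z) + q (w - 2 *\<^sub>R z)\<bar> \<le> 1" "\<bar>p (w - 2 *\<^sub>R z) - q (w - 2 *\<^sub>R z)\<bar> \<le> 1"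
          using red'[OF w] by blast
        moreover have "even (q (w - 2 *\<^sub>R z))" using 2 z by blast
        ultimately have "q (w - 2 *\<^sub>R z) = 0" by presburger
        then show ?thesis using q[OF z(2)] z(1) by (intro bexI[of _ z]) simp_all
      qed
    qed (use assms(1,2) q in \<open>auto simp: T_def intro!: span_scale span_diff\<close>)
    then show False using assms(3) by (simp add: T_def)
  qed
qed

text \<open>On a reduced vector \<open>v\<close> the square \<open>(u \<bullet> v)\<^sup>2\<close> is 0 or 1, so it only depends on the parity
  of \<open>u \<bullet> v\<close>: a linear relation between the squares becomes a relation between the characters
  \<open>w \<mapsto> cos (pi * (u \<bullet> w))\<close> and the trivial one.\<close>

lemma card_le_of_reduced:
  fixes U L :: "(real ^ 'n) set"
  assumes "finite U" "U \<subseteq> span L" "0 \<in> L"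
    and add: "\<And>x y. x \<in> L \<Longrightarrow> y \<in> L \<Longrightarrow> x + y \<in> L"
    and diff: "\<And>x y. x \<in> L \<Longrightarrow> y \<in> L \<Longrightarrow> x - y \<in> L"
    and int: "\<And>u w. u \<in> U \<Longrightarrow> w \<in> L \<Longrightarrow> u \<bullet> w \<in> \<int>"
    and one: "\<And>u. u \<in> U \<Longrightarrow> \<exists>w\<in>L. u \<bullet> w = 1"
    and neg: "\<And>u v. u \<in> U \<Longrightarrow> v \<in> U \<Longrightarrow> u \<noteq> - v"
    and red: "\<And>w. w \<in> L \<Longrightarrow> \<exists>z\<in>L. \<forall>u\<in>U. \<bar>u \<bullet> (w - 2 *\<^sub>R z)\<bar> \<le> 1"
  shows "2 * card U \<le> CARD('n) * (CARD('n) + 1)"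
proof (rule card_le_of_independent_squares[OF \<open>finite U\<close>])
  fix m u assume rel: "\<And>x. (\<Sum>u\<in>U. m u * (u \<bullet> x)\<^sup>2) = 0" and u: "u \<in> U"
  have "0 \<notin> U" using one by fastforce
  define X :: "real ^ 'n \<Rightarrow> real ^ 'n \<Rightarrow> real" where "X u w = cos (pi * (u \<bullet> w))" for u w
  \<comment> \<open>The index 0, which is not in \<open>U\<close>, stands for the trivial character;
    its coefficient collects the constant terms of the relation.\<close>
  define m' where "m' v = (if v = 0 then - (\<Sum>u\<in>U. m u) else m v)" for v
  have int': "u \<bullet> w \<in> \<int>" if "u \<in> insert 0 U" "w \<in> L" for u w
    using int that by auto
  have "m' u = 0"
  proof (rule characters_independent[where ch = X and L = L and U = "insert 0 U"])
    show "X u (x + y) = X u x * X u y" if "u \<in> insert 0 U" "x \<in> L" "y \<in> L" for u x y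
    proof -
      from int'[OF that(1,2)] int'[OF that(1,3)]
      obtain a b :: int where "u \<bullet> x = a" "u \<bullet> y = b" by (elim Ints_cases) blast
      then show ?thesis by (simp add: X_def inner_add_right distrib_left cos_add)
    qed
    have X0: "\<exists>x\<in>L. X 0 x \<noteq> X u x" if "u \<in> U" for u
      using one[OF that] by (auto simp: X_def intro!: bexI)
    show "\<exists>x\<in>L. X u x \<noteq> X v x" if "u \<in> insert 0 U" "v \<in> insert 0 U" "u \<noteq> v" for u v
    proof (cases "u = 0 \<or> v = 0")
      case True
      then show ?thesis using X0 that by (metis insertE)
    next
      case False
      then show ?thesis unfolding X_def
        using that assms(2) int neg red by (intro exists_parity_distinguishing add diff) (auto, meson)
    qed
    show "(\<Sum>u\<in>insert 0 U. m' u * X u w) = 0" if w: "w \<in> L" for w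
    proof -
      obtain z where z: "z \<in> L" "\<And>u. u \<in> U \<Longrightarrow> \<bar>u \<bullet> (w - 2 *\<^sub>R z)\<bar> \<le> 1" using red[OF w] by blast
      have sq: "(u \<bullet> (w - 2 *\<^sub>R z))\<^sup>2 = (1 - X u w) / 2" if "u \<in> U" for u
      proof -
        from int[OF that w] int[OF that z(1)]
        obtain a b :: int where ab: "u \<bullet> w = a" "u \<bullet> z = b" by (elim Ints_cases) blast
        have "\<bar>a - 2 * b\<bar> \<le> 1" using z(2)[OF that] by (simp add: inner_diff_right ab)
        then consider "a = 2 * b" | "a = 2 * b + 1" | "a = 2 * b - 1" by linarith
        then show ?thesis using cos_npi_int[of "2 * b"] sin_npi_int[of "2 * b"]
          by cases (simp_all add: inner_diff_right X_def ab distrib_left right_diff_distrib cos_add cos_diff)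
      qed
      have "0 = (\<Sum>u\<in>U. m u * ((1 - X u w) / 2))"
        using rel[of "w - 2 *\<^sub>R z"] sq by simp
      also have "\<dots> = ((\<Sum>u\<in>U. m u) - (\<Sum>u\<in>U. m u * X u w)) / 2"
        by (simp add: sum_divide_distrib sum_subtractf right_diff_distrib diff_divide_distrib)
      finally have "(\<Sum>u\<in>U. m u) = (\<Sum>u\<in>U. m u * X u w)" by simp
      moreover have "(\<Sum>u\<in>U. m' u * X u w) = (\<Sum>u\<in>U. m u * X u w)"
        using \<open>0 \<notin> U\<close> by (intro sum.cong) (auto simp: m'_def)
      ultimately show ?thesis using \<open>0 \<notin> U\<close> \<open>finite U\<close> by (simp add: m'_def X_def)
    qed
  qed (use u assms(1,3) add in \<open>auto simp: X_def\<close>)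
  then show "m u = 0" using u \<open>0 \<notin> U\<close> by (auto simp: m'_def split: if_splits)
qed

subsection \<open>Zonotopal lattices\<close>

text \<open>The functional \<open>f\<close> dual to a basis vector is bounded, so a bound on the
  norm bounds each integer coefficient.\<close>

lemma is_lattice_discrete:
  fixes L :: "(real ^ 'n) set"
  assumes "is_lattice L"
  shows "finite {z \<in> L. norm z \<le> r}"
proof -
  obtain B where B: "finite B" "independent B"
    "L = range (\<lambda>c :: real ^ 'n \<Rightarrow> int. \<Sum>b\<in>B. of_int (c b) *\<^sub>R b)"
    using assms unfolding is_lattice_def by blast
  have "\<exists>N::int. \<forall>c :: real ^ 'n \<Rightarrow> int. norm (\<Sum>b\<in>B. of_int (c b) *\<^sub>R b) \<le> r \<longrightarrow> \<bar>c b\<bar> \<le> N"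
    if b: "b \<in> B" for b
  proof -
    obtain f :: "real ^ 'n \<Rightarrow> real" where f: "linear f" "\<And>x. x \<in> B \<Longrightarrow> f x = (if x = b then 1 else 0)"
      using linear_independent_extend[OF B(2), of "\<lambda>x. if x = b then 1 else 0"] by blast
    obtain K where K: "\<And>x. norm (f x) \<le> K * norm x" using linear_bounded[OF f(1)] by blast
    have "\<bar>c b\<bar> \<le> \<lceil>\<bar>K\<bar> * r\<rceil>" if c: "norm (\<Sum>b\<in>B. of_int (c b) *\<^sub>R b) \<le> r" for c :: "real ^ 'n \<Rightarrow> int"
    proof -
      have "f (\<Sum>b\<in>B. of_int (c b) *\<^sub>R b) = (\<Sum>x\<in>B. of_int (c x) * (if x = b then 1 else 0))"
        using f by (simp add: linear_sum linear_scale)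
      also have "\<dots> = of_int (c b)" using b B(1) by (simp add: if_distrib[of "\<lambda>r. _ * r"] cong: if_cong)
      finally have "\<bar>real_of_int (c b)\<bar> \<le> K * norm (\<Sum>b\<in>B. of_int (c b) *\<^sub>R b)"
        using K[of "\<Sum>b\<in>B. of_int (c b) *\<^sub>R b"] by simp
      also have "\<dots> \<le> \<bar>K\<bar> * r" using c by (intro mult_mono) auto
      finally show ?thesis by linarith
    qed
    then show ?thesis by blast
  qed
  then obtain N :: "real ^ 'n \<Rightarrow> int" where N:
    "\<And>b c. b \<in> B \<Longrightarrow> norm (\<Sum>b\<in>B. of_int (c b) *\<^sub>R b) \<le> r \<Longrightarrow> \<bar>c b\<bar> \<le> N b"
    by metis
  have "{z \<in> L. norm z \<le> r} \<subseteq> (\<lambda>c. \<Sum>b\<in>B. of_int (c b) *\<^sub>R b) ` (PiE B (\<lambda>b. {- N b..N b}))"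
  proof
    fix z assume "z \<in> {z \<in> L. norm z \<le> r}"
    then obtain c :: "real ^ 'n \<Rightarrow> int" where c: "z = (\<Sum>b\<in>B. of_int (c b) *\<^sub>R b)" "norm z \<le> r"
      using B(3) by blast
    then have "\<bar>c b\<bar> \<le> N b" if "b \<in> B" for b using N[OF that] by blast
    \<comment> \<open>Only the values of \<open>c\<close> on \<open>B\<close> matter; restricting
      puts \<open>c\<close> into a finite set of functions.\<close>
    then have "restrict c B \<in> PiE B (\<lambda>b. {- N b..N b})" by (auto simp: abs_le_iff) (smt (verit))
    moreover have "z = (\<Sum>b\<in>B. of_int (restrict c B b) *\<^sub>R b)" using c by simp
    ultimately show "z \<in> (\<lambda>c. \<Sum>b\<in>B. of_int (c b) *\<^sub>R b) ` (PiE B (\<lambda>b. {- N b..N b}))" by blast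
  qed
  moreover have "finite (PiE B (\<lambda>b. {- N b..N b}))" using B(1) by (intro finite_PiE) auto
  ultimately show ?thesis using finite_surj by blast
qed

lemma is_lattice_bounded_cell:
  fixes L :: "(real ^ 'n) set"
  assumes "is_lattice L" "bounded (voronoi_cell L)"
  shows "bounded_cell L"
proof -
  obtain B where B: "L = range (\<lambda>c :: real ^ 'n \<Rightarrow> int. \<Sum>b\<in>B. of_int (c b) *\<^sub>R b)"
    using assms unfolding is_lattice_def by blast
  have mem: "(\<Sum>b\<in>B. of_int (c b) *\<^sub>R b) \<in> L" for c :: "real ^ 'n \<Rightarrow> int"
    unfolding B by (rule rangeI)
  show ?thesis
  proof
    show "0 \<in> L" using mem[of "\<lambda>_. 0"] by simp
  next
    fix x y assume "x \<in> L" "y \<in> L"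
    then obtain c d where "x = (\<Sum>b\<in>B. of_int (c b) *\<^sub>R b)" "y = (\<Sum>b\<in>B. of_int (d b) *\<^sub>R b)"
      unfolding B by blast
    then show "x + y \<in> L" "x - y \<in> L"
      using mem[of "\<lambda>b. c b + d b"] mem[of "\<lambda>b. c b - d b"]
      by (simp_all add: scaleR_add_left scaleR_diff_left sum.distrib sum_subtractf)
  qed (use assms is_lattice_discrete in auto)
qed

theorem theorem15:
  fixes L :: "(real ^ 'n) set"
  assumes "is_lattice L"
    and "zonotope (voronoi_cell L)"
  shows "extension_complexity (voronoi_cell L) \<le> enat (CARD('n) * (CARD('n) + 1))"
proof -
  obtain p S where S: "finite S" "nonparallel S" and pS: "voronoi_cell L = (+) p ` zon S"
    using assms(2) sum_segments_eq_translated_zon unfolding zonotope_def by metis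
  interpret bounded_cell L
    using assms(1) by (rule is_lattice_bounded_cell) (simp add: pS bounded_translation bounded_zon)
  \<comment> \<open>The Voronoi cell is symmetric about 0, so the zonotope is already
    centred.\<close>
  have "p = 0" using S(1) by (rule symmetric_translated_zon) (metis pS voronoi_cell_uminus)
  then have cell: "voronoi_cell L = zon S" using pS by simp
  have S_span: "g \<in> span L" if "g \<in> S" for g
    using mem_zon[OF S(1) that] by (simp add: cell[symmetric] voronoi_cell_def)
  have "\<exists>c>0. (\<forall>w\<in>L. g \<bullet> w / c \<in> \<int>) \<and> (\<exists>w\<in>L. g \<bullet> w = c) \<and>
      (\<forall>v\<in>L. (1/2) *\<^sub>R v \<in> voronoi_cell L \<longrightarrow> \<bar>g \<bullet> v\<bar> \<le> c)" if "g \<in> S" for g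
  proof -
    interpret bounded_cell_chords L g
      using that S S_span zon_has_chords by unfold_locales (auto simp: cell nonparallel_def)
    show ?thesis using slope_unit by metis
  qed
  then obtain c where c: "\<And>g. g \<in> S \<Longrightarrow> c g > 0" "\<And>g w. g \<in> S \<Longrightarrow> w \<in> L \<Longrightarrow> g \<bullet> w / c g \<in> \<int>"
    "\<And>g. g \<in> S \<Longrightarrow> \<exists>w\<in>L. g \<bullet> w = c g"
    "\<And>g v. g \<in> S \<Longrightarrow> v \<in> L \<Longrightarrow> (1/2) *\<^sub>R v \<in> voronoi_cell L \<Longrightarrow> \<bar>g \<bullet> v\<bar> \<le> c g"
    by metis
  \<comment> \<open>Normalised so that \<open>u g\<close> is integral on \<open>L\<close>, attains 1
    there and is at most 1 in absolute value on reduced vectors.\<close>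
  define u where "u g = (1 / c g) *\<^sub>R g" for g
  \<comment> \<open>Used with \<open>r = 1\<close> for injectivity of \<open>u\<close> and with
    \<open>r = -1\<close> to exclude opposite vectors.\<close>
  have u_eq: "g = h \<and> r = 1" if "g \<in> S" "h \<in> S" "u g = r *\<^sub>R u h" for g h r
  proof -
    have "g = c g *\<^sub>R u g" using c(1)[OF that(1)] by (simp add: u_def)
    also have "\<dots> = (c g * r / c h) *\<^sub>R h" by (simp only: that(3)) (simp add: u_def)
    finally have "g = h" using S(2) that(1,2) unfolding nonparallel_def by blast
    moreover have "u g \<noteq> 0" using S(2) c(1)[OF that(1)] that(1) by (auto simp: u_def nonparallel_def)
    ultimately show ?thesis using that(3) by (metis scaleR_cancel_right scaleR_one)
  qed
  have "inj_on u S" using u_eq[of _ _ 1] by (auto simp: inj_on_def)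
  moreover have "2 * card (u ` S) \<le> CARD('n) * (CARD('n) + 1)"
  proof (rule card_le_of_reduced[where L = L])
    show "v \<noteq> - w" if "v \<in> u ` S" "w \<in> u ` S" for v w
      using that u_eq[of _ _ "-1"] by fastforce
    show "\<exists>z\<in>L. \<forall>v\<in>u ` S. \<bar>v \<bullet> (w - 2 *\<^sub>R z)\<bar> \<le> 1" if w: "w \<in> L" for w
    proof -
      obtain z where z: "z \<in> L" "(1/2) *\<^sub>R (w - 2 *\<^sub>R z) \<in> voronoi_cell L"
        using exists_reduced[OF w] by blast
      have "w - 2 *\<^sub>R z \<in> L" using diff[OF diff[OF w z(1)] z(1)] by (simp add: scaleR_2 algebra_simps)
      then have "\<bar>u g \<bullet> (w - 2 *\<^sub>R z)\<bar> \<le> 1" if "g \<in> S" for g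
        using c(1)[OF that] c(4)[OF that _ z(2)] by (simp add: u_def abs_divide)
      then show ?thesis using z(1) by blast
    qed
    show "\<exists>w\<in>L. v \<bullet> w = 1" if v: "v \<in> u ` S" for v
    proof -
      obtain g where g: "g \<in> S" "v = u g" using v by blast
      obtain w where "w \<in> L" "g \<bullet> w = c g" using c(3)[OF g(1)] by blast
      then show ?thesis using c(1)[OF g(1)] g(2) by (intro bexI[of _ w]) (simp_all add: u_def)
    qed
  qed (use S(1) S_span c(2) zero add diff in \<open>auto simp: u_def intro: span_scale\<close>)
  ultimately have "2 * card S \<le> CARD('n) * (CARD('n) + 1)" by (simp add: card_image)
  then show ?thesis
    using extension_complexity_zon_le[OF S(1)] unfolding cell by (meson enat_ord_simps(1) order_trans)
qed

end
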